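(* The Poisson center of $H_\zeta'(\mathfrak{gl}_n)$ is the polynomial algebra $\mathbb{C}[\tau_1+c_1,\tau_2+c_2,\dots,\tau_n+c_n]$, where for $1\le i\le n$, $(-1)^ic_i$ is the coefficient of $t^i$ in the series \[ c(t)=\mathrm{Res}_{z=0}\,\zeta(z^{-1})\frac{\det(1-tA)}{\det(1-zA)}\frac{1}{1-t^{-1}z}\frac{dz}{z}. \]
   Context: Fix $n\ge1$; $e_{ij}$ matrix units of $\mathfrak{gl}_n$; $V$ with basis $y_1,\dots,y_n$, $e_{ij}y_k=\delta_{jk}y_i$; $V^*$ dual with dual basis $x_1,\dots,x_n$. Identify $S(\mathfrak{gl}_n)$ with polynomial functions of a matrix $A\in\mathfrak{gl}_n$ via the trace form. For $j\ge0$ let $\mathfrak{r}_j(y,x)\in S(\mathfrak{gl}_n)$ be the coefficient of $\tau^j$ in $(x,(1-\tau A)^{-1}y)\det(1-\tau A)^{-1}$. For $\zeta_0,\dots,\zeta_k\in\mathbb{C}$, let $\zeta(z)=\zeta_0+\zeta_1z+\dots+\zeta_kz^k$ and let $H_\zeta'(\mathfrak{gl}_n)$ be the commutative algebra $S(\mathfrak{gl}_n)\otimes S(V\oplus V^* )$ with the Poisson bracket determined on generators by $\{a,b\}=[a,b]$ for $a,b\in\mathfrak{gl}_n$, $\{g,u\}=g(u)$ for $g\in\mathfrak{gl}_n$, $u\in V\oplus V^*$, $\{y,y'\}=\{x,x'\}=0$, and $\{y,x\}=\sum_j\zeta_j\mathfrak{r}_j(y,x)$ for $y,y'\in V$, $x,x'\in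 V^*$ (this is a Poisson bracket). Let $\mathcal{Q}_k\in S(\mathfrak{gl}_n)$ be the coefficient of $(-t)^k$ in $\det(1-tA)$, and $\tau_k=\sum_{i=1}^nx_i\{\mathcal{Q}_k,y_i\}$. In $c(t)$, $1/(1-t^{-1}z)$ is expanded as $\sum_{l\ge0}z^lt^{-l}$ and $\det(1-zA)^{-1}$ as a power series in $z$. *)

theory Defs
  imports "HOL-Library.Poly_Mapping" "HOL-Computational_Algebra.Formal_Laurent_Series"
          "HOL-Combinatorics.Permutations"
begin

text \<open>Generators of S(gl_n) (x) S(V + V*): E i j = e_ij, Y i = y_i, X i = x_i (indices 0..n-1).\<close>
datatype gvar = E nat nat | Y nat | X nat

type_synonym mono = "gvar \<Rightarrow>\<^sub>0 nat"
type_synonym P = "mono \<Rightarrow>\<^sub>0 complex"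

definition pconst :: "complex \<Rightarrow> P" where
  "pconst c = Poly_Mapping.single 0 c"

definition pvar :: "gvar \<Rightarrow> P" where
  "pvar v = Poly_Mapping.single (Poly_Mapping.single v 1) 1"

definition pvars :: "(('v \<Rightarrow>\<^sub>0 nat) \<Rightarrow>\<^sub>0 complex) \<Rightarrow> 'v set" where
  "pvars p = (\<Union>m\<in>Poly_Mapping.keys p. Poly_Mapping.keys m)"

definition gens :: "nat \<Rightarrow> gvar set" where
  "gens n = {v. case v of E i j \<Rightarrow> i < n \<and> j < n | Y i \<Rightarrow> i < n | X i \<Rightarrow> i < n}"

definition Halg :: "nat \<Rightarrow> P set" where
  "Halg n = {p. pvars p \<subseteq> gens n}"

definition pdiff :: "gvar \<Rightarrow> P \<Rightarrow> P" where
  "pdiff v p = (\<Sum>m\<in>Poly_Mapping.keys p. Poly_Mapping.single (m - Poly_Mapping.single v 1)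
                      (of_nat (Poly_Mapping.lookup m v) * Poly_Mapping.lookup p m))"

definition detn :: "nat \<Rightarrow> (nat \<Rightarrow> nat \<Rightarrow> 'a::comm_ring_1) \<Rightarrow> 'a" where
  "detn n M = (\<Sum>p | p permutes {..<n}. of_int (sign p) * (\<Prod>i<n. M i (p i)))"

text \<open>The matrix A: via the trace form, e_ij is the function A |-> tr(e_ij A) = A_ji,
  so the (i,j) entry of A is the generator e_ji.\<close>
definition matA :: "nat \<Rightarrow> nat \<Rightarrow> P" where
  "matA i j = pvar (E j i)"

definition oneMinusTA :: "nat \<Rightarrow> nat \<Rightarrow> P fps" where
  "oneMinusTA i j = (if i = j then 1 else 0) - fps_const (matA i j) * fps_X"

definition detSer :: "nat \<Rightarrow> P fps" where
  "detSer n = detn n oneMinusTA"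

definition detInv :: "nat \<Rightarrow> P fps" where
  "detInv n = (THE s. s * detSer n = 1)"

definition matInv :: "nat \<Rightarrow> nat \<Rightarrow> nat \<Rightarrow> P fps" where
  "matInv n = (THE M. (\<forall>i j. (n \<le> i \<or> n \<le> j) \<longrightarrow> M i j = 0) \<and>
       (\<forall>i<n. \<forall>j<n. (\<Sum>l<n. M i l * oneMinusTA l j) = (if i = j then 1 else 0)))"

text \<open>r_j(y_k, x_l): coefficient of tau^j in (x_l, (1 - tau A)^{-1} y_k) det(1 - tau A)^{-1}.\<close>
definition rr :: "nat \<Rightarrow> nat \<Rightarrow> nat \<Rightarrow> nat \<Rightarrow> P" where
  "rr n j k l = (matInv n l k * detInv n) $ j"

text \<open>Bracket of generators; zeta(z) = zeta_0 + ... + zeta_d z^d.\<close>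
definition genbr :: "nat \<Rightarrow> nat \<Rightarrow> (nat \<Rightarrow> complex) \<Rightarrow> gvar \<Rightarrow> gvar \<Rightarrow> P" where
  "genbr n d zeta u v = (case (u, v) of
      (E i j, E k l) \<Rightarrow> (if j = k then pvar (E i l) else 0) - (if l = i then pvar (E k j) else 0)
    | (E i j, Y k) \<Rightarrow> (if j = k then pvar (Y i) else 0)
    | (E i j, X k) \<Rightarrow> - (if i = k then pvar (X j) else 0)
    | (Y k, E i j) \<Rightarrow> - (if j = k then pvar (Y i) else 0)
    | (X k, E i j) \<Rightarrow> (if i = k then pvar (X j) else 0)
    | (Y k, Y l) \<Rightarrow> 0
    | (X k, X l) \<Rightarrow> 0
    | (Y k, X l) \<Rightarrow> (\<Sum>j\<le>d. pconst (zeta j) * rr n j k l)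
    | (X l, Y k) \<Rightarrow> - (\<Sum>j\<le>d. pconst (zeta j) * rr n j k l))"

definition pbr :: "nat \<Rightarrow> nat \<Rightarrow> (nat \<Rightarrow> complex) \<Rightarrow> P \<Rightarrow> P \<Rightarrow> P" where
  "pbr n d zeta f g = (\<Sum>u\<in>gens n. \<Sum>v\<in>gens n. pdiff u f * pdiff v g * genbr n d zeta u v)"

definition poisson_center :: "nat \<Rightarrow> nat \<Rightarrow> (nat \<Rightarrow> complex) \<Rightarrow> P set" where
  "poisson_center n d zeta = {f \<in> Halg n. \<forall>g \<in> Halg n. pbr n d zeta f g = 0}"

definition QQ :: "nat \<Rightarrow> nat \<Rightarrow> P" where
  "QQ n k = (-1) ^ k * (detSer n $ k)"

definition tauk :: "nat \<Rightarrow> nat \<Rightarrow> (nat \<Rightarrow> complex) \<Rightarrow> nat \<Rightarrow> P" where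
  "tauk n d zeta k = (\<Sum>i<n. pvar (X i) * pbr n d zeta (QQ n k) (pvar (Y i)))"

text \<open>c(t) = Res_{z=0} zeta(z^{-1}) det(1-tA)/det(1-zA) 1/(1-t^{-1}z) dz/z, computed in
  Laurent series in z whose coefficients are Laurent series in t.\<close>
definition cser :: "nat \<Rightarrow> nat \<Rightarrow> (nat \<Rightarrow> complex) \<Rightarrow> P fls" where
  "cser n d zeta =
     (let zetaZ = (\<Sum>j\<le>d. fls_const (fls_const (pconst (zeta j))) * fls_X_inv ^ j) :: P fls fls;
          numZ = fls_const (fps_to_fls (detSer n)) :: P fls fls;
          invdetZ = fps_to_fls (Abs_fps (\<lambda>m. fls_const (detInv n $ m))) :: P fls fls;
          geomZ = fps_to_fls (Abs_fps (\<lambda>l. (fls_X_inv :: P fls) ^ l)) :: P fls fls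
      in fls_residue (zetaZ * numZ * invdetZ * geomZ * fls_X_inv))"

definition cc :: "nat \<Rightarrow> nat \<Rightarrow> (nat \<Rightarrow> complex) \<Rightarrow> nat \<Rightarrow> P" where
  "cc n d zeta i = (-1) ^ i * fls_nth (cser n d zeta) (int i)"

definition peval :: "((nat \<Rightarrow>\<^sub>0 nat) \<Rightarrow>\<^sub>0 complex) \<Rightarrow> (nat \<Rightarrow> P) \<Rightarrow> P" where
  "peval q g = (\<Sum>m\<in>Poly_Mapping.keys q. pconst (Poly_Mapping.lookup q m) * (\<Prod>i\<in>Poly_Mapping.keys m. g i ^ Poly_Mapping.lookup m i))"

end

theory Submission
  imports Defs "Jordan_Normal_Form.Determinant" "HOL-Computational_Algebra.Polynomial_FPS"
begin

text \<open>
  Centrality of \<open>\<tau>\<^sub>i + c\<^sub>i\<close> is checked on generators. With \<open>B(t)\<close> the adjugate of \<open>1 - tA\<close> and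
  \<open>D(t) = det(1 - tA)\<close>, Jacobi's formula gives \<open>\<Sum> (-t)\<^sup>k \<tau>\<^sub>k = - t y\<^sup>T B(t) x\<close>, and the brackets of
  \<open>\<tau>\<^sub>i\<close> and \<open>c\<^sub>i\<close> with \<open>y\<^sub>k\<close> and \<open>x\<^sub>k\<close> cancel by the resolvent identity for
  \<open>D(t) / D(z)\<close>, which becomes a telescoping sum of coefficients.

  Conversely, consider the slice \<open>e\<^sub>i\<^sub>j = \<delta>\<^bsub>j,i+1\<^esub>\<close>, \<open>x\<^sub>j = \<delta>\<^bsub>j,0\<^esub>\<close>, with \<open>y\<close> free. There
  \<open>A\<close> is nilpotent, so \<open>c\<^sub>i\<close> vanishes and \<open>\<tau>\<^sub>i\<close> restricts to \<open>y\<^bsub>i-1\<^esub>\<close> up to sign (generators are indexed from 0): restriction to the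
  slice inverts polynomial evaluation at the \<open>\<tau>\<^sub>i + c\<^sub>i\<close>, which gives algebraic independence. A central
  \<open>f\<close> is determined by its restriction, because along the slice the Hamiltonian fields of the \<open>e\<^sub>i\<^sub>j\<close>
  and \<open>x\<^sub>k\<close> span the normal directions: after rescaling these directions by a parameter, \<open>f\<close>
  satisfies a linear homogeneous differential equation in the parameter, with zero initial value if
  \<open>f\<close> vanishes on the slice.
\<close>

section \<open>Polynomials over the complex numbers: evaluation and derivations\<close>

no_notation Matrix.vec_index (infixl "$" 100)

type_synonym 'v cpoly = "('v \<Rightarrow>\<^sub>0 nat) \<Rightarrow>\<^sub>0 complex"

definition cst :: "complex \<Rightarrow> 'v cpoly" where
  "cst c = Poly_Mapping.single 0 c"

definition var :: "'v \<Rightarrow> 'v cpoly" where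
  "var v = Poly_Mapping.single (Poly_Mapping.single v 1) 1"

lemma pconst_eq_cst: "pconst = cst" and pvar_eq_var: "pvar = var"
  by (auto simp: fun_eq_iff pconst_def cst_def pvar_def var_def)

lemma sum_singles:
  "p = (\<Sum>m\<in>Poly_Mapping.keys p. Poly_Mapping.single m (Poly_Mapping.lookup p m))"
proof (rule poly_mapping_eqI)
  fix k
  show "Poly_Mapping.lookup p k =
      Poly_Mapping.lookup (\<Sum>m\<in>Poly_Mapping.keys p. Poly_Mapping.single m (Poly_Mapping.lookup p m)) k"
    by (cases "k \<in> Poly_Mapping.keys p")
       (auto simp: lookup_sum lookup_single when_def sum.delta' in_keys_iff)
qed

lemma poly_mapping_add_induct [case_names zero single add]:
  assumes "P 0" "\<And>m c. P (Poly_Mapping.single m c)" "\<And>p q. P p \<Longrightarrow> P q \<Longrightarrow> P (p + q)"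
  shows "P (p :: 'a \<Rightarrow>\<^sub>0 'b::comm_monoid_add)"
proof -
  have "P (\<Sum>m\<in>K. Poly_Mapping.single m (Poly_Mapping.lookup p m))" if "finite K" for K
    using that by (induction K) (auto intro: assms)
  from this[of "Poly_Mapping.keys p"] show ?thesis
    using sum_singles[of p] by simp
qed

lemma cst_0 [simp]: "cst 0 = 0" and cst_1 [simp]: "cst 1 = 1"
  and cst_add: "cst (a + b) = cst a + cst b" and cst_mult: "cst (a * b) = cst a * cst b"
  by (auto simp: cst_def single_add mult_single)

definition monval :: "('v \<Rightarrow> 'r::comm_ring_1) \<Rightarrow> ('v \<Rightarrow>\<^sub>0 nat) \<Rightarrow> 'r" where
  "monval g m = (\<Prod>i\<in>Poly_Mapping.keys m. g i ^ Poly_Mapping.lookup m i)"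

definition ev :: "(complex \<Rightarrow> 'r) \<Rightarrow> ('v \<Rightarrow> 'r::comm_ring_1) \<Rightarrow> 'v cpoly \<Rightarrow> 'r" where
  "ev \<kappa> g p = (\<Sum>m\<in>Poly_Mapping.keys p. \<kappa> (Poly_Mapping.lookup p m) * monval g m)"

lemma monval_superset:
  assumes "finite K" "Poly_Mapping.keys m \<subseteq> K"
  shows "monval g m = (\<Prod>i\<in>K. g i ^ Poly_Mapping.lookup m i)"
  unfolding monval_def using assms
  by (intro prod.mono_neutral_left) (auto simp: in_keys_iff)

lemma monval_add: "monval g (a + b) = monval g a * monval g b"
proof -
  let ?K = "Poly_Mapping.keys a \<union> Poly_Mapping.keys b"
  have "monval g (a + b) = (\<Prod>i\<in>?K. g i ^ Poly_Mapping.lookup (a + b) i)"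
    by (intro monval_superset) (auto dest: set_mp[OF keys_add])
  also have "\<dots> = (\<Prod>i\<in>?K. g i ^ Poly_Mapping.lookup a i) * (\<Prod>i\<in>?K. g i ^ Poly_Mapping.lookup b i)"
    by (simp add: lookup_add power_add prod.distrib)
  also have "\<dots> = monval g a * monval g b"
    by (intro arg_cong2[of _ _ _ _ "(*)"] monval_superset[symmetric]) auto
  finally show ?thesis .
qed

lemma monval_0 [simp]: "monval g 0 = 1"
  by (simp add: monval_def)

lemma monval_single [simp]: "monval g (Poly_Mapping.single v k) = g v ^ k"
  by (cases "k = 0") (auto simp: monval_def)

lemma ev_superset:
  assumes "\<kappa> 0 = 0" "finite K" "Poly_Mapping.keys p \<subseteq> K"
  shows "ev \<kappa> g p = (\<Sum>m\<in>K. \<kappa> (Poly_Mapping.lookup p m) * monval g m)"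
  unfolding ev_def using assms
  by (intro sum.mono_neutral_left) (auto simp: in_keys_iff)

lemma ev_0 [simp]: "ev \<kappa> g 0 = 0"
  by (simp add: ev_def)

lemma ev_single: "\<kappa> 0 = 0 \<Longrightarrow> ev \<kappa> g (Poly_Mapping.single m c) = \<kappa> c * monval g m"
  by (auto simp: ev_def)

context
  fixes \<kappa> :: "complex \<Rightarrow> 'r::comm_ring_1"
  assumes \<kappa>: "comm_ring_hom \<kappa>"
begin

interpretation k: comm_ring_hom \<kappa> by (fact \<kappa>)

lemma ev_add: "ev \<kappa> g (p + q) = ev \<kappa> g p + ev \<kappa> g q"
proof -
  let ?K = "Poly_Mapping.keys p \<union> Poly_Mapping.keys q"
  have "ev \<kappa> g (p + q) = (\<Sum>m\<in>?K. \<kappa> (Poly_Mapping.lookup (p + q) m) * monval g m)"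
    by (intro ev_superset) (auto dest: set_mp[OF keys_add])
  also have "\<dots> = (\<Sum>m\<in>?K. \<kappa> (Poly_Mapping.lookup p m) * monval g m)
      + (\<Sum>m\<in>?K. \<kappa> (Poly_Mapping.lookup q m) * monval g m)"
    by (simp add: lookup_add k.hom_add distrib_right sum.distrib)
  also have "\<dots> = ev \<kappa> g p + ev \<kappa> g q"
    by (intro arg_cong2[of _ _ _ _ "(+)"] ev_superset[symmetric]) auto
  finally show ?thesis .
qed

lemma ev_mult: "ev \<kappa> g (p * q) = ev \<kappa> g p * ev \<kappa> g q"
proof (induction p rule: poly_mapping_add_induct)
  case (single a c)
  show ?case
    by (induction q rule: poly_mapping_add_induct)
       (simp_all add: mult_single ev_single monval_add k.hom_mult ev_add algebra_simps)
qed (simp_all add: ev_add distrib_right)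

lemma ev_cst [simp]: "ev \<kappa> g (cst c) = \<kappa> c"
  by (simp add: cst_def ev_single)

lemma ev_var [simp]: "ev \<kappa> g (var v) = g v"
  by (simp add: var_def ev_single)

lemma ev_hom: "comm_ring_hom (ev \<kappa> g)"
  using ev_cst[of g 0] ev_cst[of g 1]
  by unfold_locales (auto simp: ev_add ev_mult)

end

lemma cst_hom: "comm_ring_hom cst"
  by unfold_locales (auto simp: cst_add cst_mult)

lemma pvars_0 [simp]: "pvars 0 = {}" and pvars_cst [simp]: "pvars (cst c) = {}"
  and pvars_var [simp]: "pvars (var v) = {v}"
  by (auto simp: pvars_def cst_def var_def)

lemma pvars_add: "pvars (p + q) \<subseteq> pvars p \<union> pvars q"
  unfolding pvars_def using keys_add[of p q] by blast

lemma pvars_mult: "pvars (p * q) \<subseteq> pvars p \<union> pvars q"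
  unfolding pvars_def
proof safe
  fix x m assume *: "m \<in> Poly_Mapping.keys (p * q)" "x \<in> Poly_Mapping.keys m"
    "x \<notin> (\<Union>m\<in>Poly_Mapping.keys q. Poly_Mapping.keys m)"
  then obtain a b where "a \<in> Poly_Mapping.keys p" "b \<in> Poly_Mapping.keys q" "m = a + b"
    using keys_mult[of p q] by blast
  with * keys_add[of a b] show "x \<in> (\<Union>m\<in>Poly_Mapping.keys p. Poly_Mapping.keys m)"
    by blast
qed

lemma pvars_uminus [simp]: "pvars (- p) = pvars p"
  by (simp add: pvars_def)

definition polys :: "'v set \<Rightarrow> 'v cpoly set" where
  "polys S = {p. pvars p \<subseteq> S}"

lemma Halg_eq_polys: "Halg n = polys (gens n)"
  by (simp add: Halg_def polys_def)

lemma polys_cst [simp, intro]: "cst c \<in> polys S"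
  and polys_0 [simp, intro]: "0 \<in> polys S" and polys_1 [simp, intro]: "1 \<in> polys S"
  and polys_var [simp]: "var v \<in> polys S \<longleftrightarrow> v \<in> S"
  using pvars_cst[of 1] by (auto simp: polys_def)

lemma polys_add [intro]: "p \<in> polys S \<Longrightarrow> q \<in> polys S \<Longrightarrow> p + q \<in> polys S"
  using pvars_add[of p q] by (auto simp: polys_def)

lemma polys_mult [intro]: "p \<in> polys S \<Longrightarrow> q \<in> polys S \<Longrightarrow> p * q \<in> polys S"
  using pvars_mult[of p q] by (auto simp: polys_def)

lemma polys_uminus [intro]: "p \<in> polys S \<Longrightarrow> - p \<in> polys S"
  by (auto simp: polys_def)

lemma polys_diff [intro]: "p \<in> polys S \<Longrightarrow> q \<in> polys S \<Longrightarrow> p - q \<in> polys S"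
  using polys_add[of p S "- q"] by auto

lemma polys_sum [intro]: "(\<And>i. i \<in> I \<Longrightarrow> f i \<in> polys S) \<Longrightarrow> sum f I \<in> polys S"
  by (induction I rule: infinite_finite_induct) auto

lemma polys_power [intro]: "p \<in> polys S \<Longrightarrow> p ^ k \<in> polys S"
  by (induction k) auto

lemma single_eq_monval: "Poly_Mapping.single m c = cst c * monval var m"
proof -
  have pw: "var v ^ k = Poly_Mapping.single (Poly_Mapping.single v k) 1" for v :: 'a and k
    by (induction k) (auto simp: var_def mult_single single_add[symmetric])
  have "(\<Prod>i\<in>K. Poly_Mapping.single (f i) (1::complex)) = Poly_Mapping.single (sum f K) 1"
    if "finite K" for K and f :: "'a \<Rightarrow> ('a \<Rightarrow>\<^sub>0 nat)"
    using that by induction (auto simp: mult_single)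
  then have "monval var m = Poly_Mapping.single m 1"
    using sum_singles[of m] by (simp add: monval_def pw)
  then show ?thesis by (simp add: cst_def mult_single)
qed

lemma polys_induct [consumes 1, case_names cst var add mult]:
  assumes "p \<in> polys S" and c: "\<And>c. P (cst c)" and v: "\<And>v. v \<in> S \<Longrightarrow> P (var v)"
    and a: "\<And>p q. p \<in> polys S \<Longrightarrow> q \<in> polys S \<Longrightarrow> P p \<Longrightarrow> P q \<Longrightarrow> P (p + q)"
    and m: "\<And>p q. p \<in> polys S \<Longrightarrow> q \<in> polys S \<Longrightarrow> P p \<Longrightarrow> P q \<Longrightarrow> P (p * q)"
  shows "P p"
proof -
  let ?P = "\<lambda>p. p \<in> polys S \<and> P p"
  have 0: "?P 0" and 1: "?P 1" using c[of 0] c[of 1] by auto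
  have pw: "?P (var v ^ k)" if "v \<in> S" for v k
    using that by (induction k) (use 1 in \<open>auto intro: v m\<close>)
  have pr: "?P (\<Prod>i\<in>K. var i ^ f i)" if "finite K" "K \<subseteq> S" for K f
    using that by induction (use 1 pw in \<open>auto intro: m\<close>)
  have mv: "?P (monval var k)" if "k \<in> Poly_Mapping.keys p" for k
    unfolding monval_def using that assms(1) by (intro pr) (auto simp: polys_def pvars_def)
  have "?P (\<Sum>k\<in>K. cst (Poly_Mapping.lookup p k) * monval var k)"
    if "finite K" "K \<subseteq> Poly_Mapping.keys p" for K
    using that
  proof induction
    case (insert x F)
    then show ?case using mv[of x] c by (auto intro: a m)
  qed (use 0 in auto)
  from this[of "Poly_Mapping.keys p"] sum_singles[of p] show ?thesis
    by (simp add: single_eq_monval)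
qed

lemma polys_UNIV [simp]: "p \<in> polys UNIV"
  by (simp add: polys_def)

lemma peval_eq_ev: "peval q g = ev cst g q"
  by (simp add: peval_def ev_def monval_def pconst_eq_cst)

lemma hom_eqI:
  assumes "comm_ring_hom h" "comm_ring_hom h'" "p \<in> polys S"
    and "\<And>c. h (cst c) = h' (cst c)" "\<And>v. v \<in> S \<Longrightarrow> h (var v) = h' (var v)"
  shows "h p = h' p"
proof -
  interpret h: comm_ring_hom h by fact
  interpret h': comm_ring_hom h' by fact
  show ?thesis using assms(3)
    by (induction p rule: polys_induct) (auto simp: assms h.hom_add h'.hom_add h.hom_mult h'.hom_mult)
qed

lemma ev_in_polys:
  assumes "p \<in> polys S" "\<And>v. v \<in> S \<Longrightarrow> g v \<in> polys T"
  shows "ev cst g p \<in> polys T"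
proof -
  interpret h: comm_ring_hom "ev cst g" by (intro ev_hom cst_hom)
  show ?thesis using assms(1)
    by (induction p rule: polys_induct) (auto simp: ev_cst[OF cst_hom] ev_var[OF cst_hom] assms h.hom_add h.hom_mult)
qed

locale derivation =
  fixes h :: "'a::comm_ring_1 \<Rightarrow> 'b::comm_ring_1" and \<delta> :: "'a \<Rightarrow> 'b"
  assumes hom: "comm_ring_hom h"
    and add: "\<delta> (a + b) = \<delta> a + \<delta> b" and mult: "\<delta> (a * b) = \<delta> a * h b + h a * \<delta> b"
begin

lemma zero [simp]: "\<delta> 0 = 0"
  using add[of 0 0] by simp

lemma one [simp]: "\<delta> 1 = 0"
proof -
  interpret h: comm_ring_hom h by (fact hom)
  show ?thesis using mult[of 1 1] by simp
qed

lemma uminus: "\<delta> (- a) = - \<delta> a"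
  using add[of a "- a"] by (simp add: add_eq_0_iff2 add_eq_0_iff)

lemma diff: "\<delta> (a - b) = \<delta> a - \<delta> b"
  using add[of a "- b"] by (simp add: uminus)

lemma sum: "\<delta> (sum f I) = (\<Sum>i\<in>I. \<delta> (f i))"
  by (induction I rule: infinite_finite_induct) (auto simp: add)

lemma of_int [simp]: "\<delta> (of_int k) = 0"
proof -
  have nat: "\<delta> (of_nat k) = 0" for k
    by (induction k) (auto simp: add)
  show ?thesis
    by (cases k) (auto simp: nat uminus diff)
qed

lemma prod:
  "finite I \<Longrightarrow> \<delta> (prod f I) = (\<Sum>i\<in>I. \<delta> (f i) * (\<Prod>j\<in>I - {i}. h (f j)))"
proof (induction I rule: finite_induct)
  case (insert x F)
  interpret h: comm_ring_hom h by (fact hom)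
  have *: "(\<Prod>j\<in>insert x F - {i}. h (f j)) = h (f x) * (\<Prod>j\<in>F - {i}. h (f j))" if "i \<in> F" for i
    using insert that by (subst insert_Diff_if) (auto intro!: prod.insert)
  show ?case
    using insert by (simp add: mult * h.hom_prod sum_distrib_left mult_ac)
qed auto

end

definition pd :: "'v \<Rightarrow> 'v cpoly \<Rightarrow> 'v cpoly" where
  "pd v p = (\<Sum>m\<in>Poly_Mapping.keys p. Poly_Mapping.single (m - Poly_Mapping.single v 1)
                      (of_nat (Poly_Mapping.lookup m v) * Poly_Mapping.lookup p m))"

lemma pdiff_eq_pd: "pdiff = pd"
  by (simp add: fun_eq_iff pdiff_def pd_def)

lemma pd_superset:
  assumes "finite K" "Poly_Mapping.keys p \<subseteq> K"
  shows "pd v p = (\<Sum>m\<in>K. Poly_Mapping.single (m - Poly_Mapping.single v 1)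
                      (of_nat (Poly_Mapping.lookup m v) * Poly_Mapping.lookup p m))"
  unfolding pd_def using assms
  by (intro sum.mono_neutral_left) (auto simp: in_keys_iff)

lemma pd_add: "pd v (p + q) = pd v p + pd v q"
proof -
  let ?K = "Poly_Mapping.keys p \<union> Poly_Mapping.keys q"
  let ?s = "\<lambda>r m. Poly_Mapping.single (m - Poly_Mapping.single v 1)
                      (of_nat (Poly_Mapping.lookup m v) * Poly_Mapping.lookup r m)"
  have "pd v (p + q) = (\<Sum>m\<in>?K. ?s (p + q) m)"
    by (intro pd_superset) (auto dest: set_mp[OF keys_add])
  also have "\<dots> = sum (?s p) ?K + sum (?s q) ?K"
    by (simp add: lookup_add distrib_left single_add sum.distrib)
  also have "\<dots> = pd v p + pd v q"
    by (intro arg_cong2[of _ _ _ _ "(+)"] pd_superset[symmetric]) auto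
  finally show ?thesis .
qed

lemma pd_single:
  "pd v (Poly_Mapping.single m c) =
     Poly_Mapping.single (m - Poly_Mapping.single v 1) (of_nat (Poly_Mapping.lookup m v) * c)"
  by (auto simp: pd_def)

lemma pd_0 [simp]: "pd v 0 = 0"
  by (simp add: pd_def)

lemma pd_mult: "pd v (p * q) = pd v p * q + p * pd v q"
proof (induction p rule: poly_mapping_add_induct)
  case (single a c)
  let ?v = "Poly_Mapping.single v (1::nat)"
  have minus: "m + k - ?v = (m - ?v) + k" if "Poly_Mapping.lookup m v \<noteq> 0"
    for m k :: "'a \<Rightarrow>\<^sub>0 nat"
    using that by (intro poly_mapping_eqI) (auto simp: lookup_minus lookup_add lookup_single when_def)
  have *: "pd v (Poly_Mapping.single a c * Poly_Mapping.single b e) =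
      pd v (Poly_Mapping.single a c) * Poly_Mapping.single b e +
      Poly_Mapping.single a c * pd v (Poly_Mapping.single b e)" for b e
    using minus[of a b] minus[of b a]
    by (cases "Poly_Mapping.lookup a v = 0"; cases "Poly_Mapping.lookup b v = 0")
       (simp_all add: mult_single pd_single lookup_add single_add[symmetric] algebra_simps)
  show ?case
    by (induction q rule: poly_mapping_add_induct) (simp_all add: * pd_add distrib_left add_ac)
qed (simp_all add: pd_add distrib_right)

lemma id_hom: "comm_ring_hom (\<lambda>x. x)"
  by unfold_locales auto

lemma pd_derivation: "derivation (\<lambda>x. x) (pd v)"
  by (intro derivation.intro id_hom) (simp_all add: pd_add pd_mult)

lemma pd_cst [simp]: "pd v (cst c) = 0"
  by (simp add: cst_def pd_single)

lemma pd_var: "pd v (var u) = (if u = v then 1 else 0)"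
  by (auto simp: var_def pd_single lookup_single)

lemma derivation_chain:
  assumes "derivation h \<delta>" "\<And>c. \<delta> (cst c) = 0" "finite S" "p \<in> polys S"
  shows "\<delta> p = (\<Sum>v\<in>S. h (pd v p) * \<delta> (var v))"
proof -
  interpret derivation h \<delta> by fact
  interpret h: comm_ring_hom h by (fact hom)
  show ?thesis using assms(4)
  proof (induction p rule: polys_induct)
    case (var u)
    have "(\<Sum>v\<in>S. h (pd v (var u)) * \<delta> (var v)) = (\<Sum>v\<in>S. if u = v then \<delta> (var v) else 0)"
      by (intro sum.cong) (auto simp: pd_var)
    then show ?case using var assms(3) by simp
  next
    case (mult p q)
    show ?case
      unfolding mult pd_mult h.hom_add h.hom_mult distrib_right sum.distrib
        sum_distrib_left sum_distrib_right derivation.mult[OF assms(1)]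
      by (simp add: mult_ac add.commute)
  qed (auto simp: assms pd_add add h.hom_add distrib_right sum.distrib)
qed

section \<open>Determinants and adjugates\<close>

definition mmul :: "nat \<Rightarrow> (nat \<Rightarrow> nat \<Rightarrow> 'a::comm_ring_1) \<Rightarrow> (nat \<Rightarrow> nat \<Rightarrow> 'a) \<Rightarrow> nat \<Rightarrow> nat \<Rightarrow> 'a" where
  "mmul n M N i j = (\<Sum>k<n. M i k * N k j)"

lemma mmul_assoc: "mmul n (mmul n A B) C = mmul n A (mmul n B C)"
  unfolding mmul_def sum_distrib_left sum_distrib_right fun_eq_iff
  by (subst sum.swap) (simp add: mult_ac)

definition adjn :: "nat \<Rightarrow> (nat \<Rightarrow> nat \<Rightarrow> 'a::comm_ring_1) \<Rightarrow> nat \<Rightarrow> nat \<Rightarrow> 'a" where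
  "adjn n M i j = cofactor (mat n n (\<lambda>(i, j). M i j)) j i"

lemma detn_eq_det: "detn n M = det (mat n n (\<lambda>(i, j). M i j))"
  unfolding detn_def det_def
  by (auto simp: lessThan_atLeast0 permutes_in_image intro!: sum.cong prod.cong)

lemma mmul_adjn:
  assumes "i < n" "j < n"
  shows "mmul n M (adjn n M) i j = (if i = j then detn n M else 0)"
    and "mmul n (adjn n M) M i j = (if i = j then detn n M else 0)"
proof -
  let ?M = "mat n n (\<lambda>(i, j). M i j)"
  have M: "?M \<in> carrier_mat n n" by simp
  have "mmul n M (adjn n M) i j = (?M * adj_mat ?M) $$ (i, j)"
    using assms by (auto simp: adj_mat_def scalar_prod_def mmul_def adjn_def lessThan_atLeast0 intro!: sum.cong)
  also have "\<dots> = (if i = j then detn n M else 0)"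
    unfolding adj_mat(2)[OF M] using assms by (simp add: detn_eq_det)
  finally show "mmul n M (adjn n M) i j = (if i = j then detn n M else 0)" .
  have "mmul n (adjn n M) M i j = (adj_mat ?M * ?M) $$ (i, j)"
    using assms by (auto simp: adj_mat_def scalar_prod_def mmul_def adjn_def lessThan_atLeast0 intro!: sum.cong)
  also have "\<dots> = (if i = j then detn n M else 0)"
    unfolding adj_mat(3)[OF M] using assms by (simp add: detn_eq_det)
  finally show "mmul n (adjn n M) M i j = (if i = j then detn n M else 0)" .
qed

lemma detn_row_expansion:
  assumes "i < n"
  shows "detn n (M(i := r)) = (\<Sum>j<n. r j * adjn n M j i)"
proof -
  let ?M = "mat n n (\<lambda>(i, j). M i j)" and ?N = "mat n n (\<lambda>(i', j). (M(i := r)) i' j)"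
  have cof: "cofactor ?N i j = cofactor ?M i j" if "j < n" for j
  proof -
    have "mat_delete ?N i j = mat_delete ?M i j"
      using assms that by (intro eq_matI) (auto simp: mat_delete_def)
    then show ?thesis by (simp add: cofactor_def)
  qed
  have "detn n (M(i := r)) = (\<Sum>j<n. ?N $$ (i, j) * cofactor ?N i j)"
    unfolding detn_eq_det using assms by (intro laplace_expansion_row) auto
  also have "\<dots> = (\<Sum>j<n. r j * adjn n M j i)"
    using assms by (intro sum.cong) (simp_all add: cof adjn_def fun_upd_same del: fun_upd_apply)
  finally show ?thesis .
qed

lemma derivation_detn:
  assumes "derivation (\<lambda>x. x) \<delta>"
  shows "\<delta> (detn n M) = (\<Sum>i<n. \<Sum>j<n. \<delta> (M i j) * adjn n M j i)"
proof -
  interpret derivation "\<lambda>x. x" \<delta> by fact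
  have "\<delta> (detn n M) = (\<Sum>p | p permutes {..<n}. \<Sum>i<n.
      of_int (sign p) * (\<delta> (M i (p i)) * (\<Prod>k\<in>{..<n} - {i}. M k (p k))))"
    unfolding detn_def by (simp add: sum mult prod sum_distrib_left)
  also have "\<dots> = (\<Sum>i<n. \<Sum>p | p permutes {..<n}.
      of_int (sign p) * (\<Prod>k<n. (M(i := \<lambda>j. \<delta> (M i j))) k (p k)))"
  proof (subst sum.swap, intro sum.cong refl)
    fix i p assume i: "i \<in> {..<n}"
    show "of_int (sign p) * (\<delta> (M i (p i)) * (\<Prod>k\<in>{..<n} - {i}. M k (p k))) =
        of_int (sign p) * (\<Prod>k<n. (M(i := \<lambda>j. \<delta> (M i j))) k (p k))"
      unfolding prod.remove[OF finite_lessThan i] by (auto intro!: prod.cong)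
  qed
  also have "\<dots> = (\<Sum>i<n. detn n (M(i := \<lambda>j. \<delta> (M i j))))"
    by (simp add: detn_def)
  finally show ?thesis
    by (simp add: detn_row_expansion)
qed

lemma (in comm_ring_hom) hom_detn: "hom (detn n M) = detn n (\<lambda>i j. hom (M i j))"
  by (simp add: detn_def hom_distribs)

lemma detn_lower_unitriangular:
  assumes "\<And>i j. i < j \<Longrightarrow> j < n \<Longrightarrow> M i j = 0" "\<And>i. i < n \<Longrightarrow> M i i = 1"
  shows "detn n M = 1"
proof -
  let ?M = "mat n n (\<lambda>(i, j). M i j)"
  have "det ?M = prod_list (diag_mat ?M)"
    using assms by (intro det_lower_triangular[of n]) auto
  also have "diag_mat ?M = map (\<lambda>i. 1) [0..<n]"
    using assms by (auto simp: diag_mat_def)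
  finally show ?thesis
    by (simp add: detn_eq_det map_replicate_const)
qed

lemma sum_delta_mult:
  fixes n :: nat and f :: "nat \<Rightarrow> 'a::comm_ring_1"
  assumes "i < n"
  shows "(\<Sum>k<n. (if i = k then c else 0) * f k) = c * f i"
    and "(\<Sum>k<n. f k * (if k = i then c else 0)) = f i * c"
    and "(\<Sum>k<n. (if k = i then c else 0) * f k) = c * f i"
    and "(\<Sum>k<n. f k * (if i = k then c else 0)) = f i * c"
  using assms by (auto simp: if_distrib[of "\<lambda>x. x * _"] if_distrib[of "\<lambda>x. _ * x"] cong: if_cong)

lemma row_mult_cancel:
  fixes D :: "'a::comm_ring_1"
  assumes D: "D = detn n M" "h * D = 1" and "i < n"
    and "\<And>j. j < n \<Longrightarrow> (\<Sum>k<n. r k * M k j) = 0"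
  shows "r i = 0"
proof -
  have "0 = (\<Sum>j<n. (\<Sum>k<n. r k * M k j) * adjn n M j i)"
    by (simp add: assms)
  also have "\<dots> = (\<Sum>k<n. r k * mmul n M (adjn n M) k i)"
    unfolding mmul_def sum_distrib_left sum_distrib_right
    by (subst sum.swap) (simp add: mult_ac)
  also have "\<dots> = (\<Sum>k<n. r k * (if k = i then D else 0))"
    using assms(3) D by (intro sum.cong) (auto simp: mmul_adjn)
  also have "\<dots> = r i * D" using assms(3) by (rule sum_delta_mult)
  finally have "h * (r i * D) = 0" by simp
  then have "r i * (h * D) = 0" by (simp add: mult_ac)
  then show ?thesis using D by simp
qed

lemma col_mult_cancel:
  fixes D :: "'a::comm_ring_1"
  assumes D: "D = detn n M" "h * D = 1" and "i < n"
    and "\<And>j. j < n \<Longrightarrow> (\<Sum>k<n. M j k * c k) = 0"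
  shows "c i = 0"
proof -
  have "0 = (\<Sum>j<n. adjn n M i j * (\<Sum>k<n. M j k * c k))"
    by (simp add: assms)
  also have "\<dots> = (\<Sum>k<n. mmul n (adjn n M) M i k * c k)"
    unfolding mmul_def sum_distrib_left sum_distrib_right
    by (subst sum.swap) (simp add: mult_ac)
  also have "\<dots> = (\<Sum>k<n. (if i = k then D else 0) * c k)"
    using assms(3) D by (intro sum.cong) (auto simp: mmul_adjn)
  also have "\<dots> = D * c i" using assms(3) by (rule sum_delta_mult)
  finally have "h * (D * c i) = 0" by simp
  then have "(h * D) * c i = 0" by (simp add: mult_ac)
  then show ?thesis using D by simp
qed

definition dfps :: "('a \<Rightarrow> 'a) \<Rightarrow> 'a::comm_ring_1 fps \<Rightarrow> 'a fps" where
  "dfps \<delta> F = Abs_fps (\<lambda>m. \<delta> (fps_nth F m))"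

lemma fps_nth_dfps [simp]: "fps_nth (dfps \<delta> F) m = \<delta> (fps_nth F m)"
  by (simp add: dfps_def)

lemma dfps_derivation:
  assumes "derivation (\<lambda>x. x) \<delta>"
  shows "derivation (\<lambda>x. x) (dfps \<delta>)"
proof -
  interpret derivation "\<lambda>x. x" \<delta> by fact
  show ?thesis
    by (intro derivation.intro id_hom)
       (simp_all add: fps_eq_iff add fps_mult_nth sum mult sum.distrib)
qed

lemma dfps_const: "\<delta> 0 = 0 \<Longrightarrow> dfps \<delta> (fps_const c) = fps_const (\<delta> c)"
  by (simp add: fps_eq_iff)

section \<open>Coefficients of the resolvent\<close>

abbreviation "tA \<equiv> oneMinusTA"

definition Bser :: "nat \<Rightarrow> nat \<Rightarrow> nat \<Rightarrow> P fps" where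
  "Bser n = adjn n oneMinusTA"

definition Dc :: "nat \<Rightarrow> nat \<Rightarrow> P" where
  "Dc n a = fps_nth (detSer n) a"

definition hc :: "nat \<Rightarrow> nat \<Rightarrow> P" where
  "hc n a = fps_nth (detInv n) a"

definition Bc :: "nat \<Rightarrow> nat \<Rightarrow> nat \<Rightarrow> nat \<Rightarrow> P" where
  "Bc n a i j = fps_nth (Bser n i j) a"

text \<open>Matrix convention: row index first, whereas \<^const>\<open>rr\<close> takes the index of \<open>y\<close>, which is the column.\<close>

definition Rc :: "nat \<Rightarrow> nat \<Rightarrow> nat \<Rightarrow> nat \<Rightarrow> P" where
  "Rc n a i j = rr n a j i"

lemma fps_nth_0_hom: "comm_ring_hom (\<lambda>F :: P fps. fps_nth F 0)"
  by unfold_locales (simp_all add: fps_mult_nth)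

lemma Dc_0: "Dc n 0 = 1"
proof -
  interpret comm_ring_hom "\<lambda>F :: P fps. fps_nth F 0" by (fact fps_nth_0_hom)
  show ?thesis
    unfolding Dc_def detSer_def hom_detn
    by (rule detn_lower_unitriangular) (auto simp: oneMinusTA_def)
qed

lemma detInv: "detInv n * detSer n = 1"
  unfolding detInv_def
proof (rule theI')
  show "\<exists>!s. s * detSer n = 1"
  proof (rule ex_ex1I)
    show "\<exists>s. s * detSer n = 1"
      using fps_right_inverse[of "detSer n" 1] Dc_0[of n] unfolding Dc_def
      by (metis mult.commute mult_1)
  next
    fix s s' assume s: "s * detSer n = 1" "s' * detSer n = 1"
    have "s = s * (s' * detSer n)" using s by simp
    also have "\<dots> = s' * (s * detSer n)" by (simp add: mult_ac)
    finally show "s = s'" using s by simp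
  qed
qed

lemma hc_0: "hc n 0 = 1"
  using arg_cong[OF detInv[of n], of "\<lambda>F. fps_nth F 0"] Dc_0[of n]
  by (simp add: hc_def Dc_def fps_mult_nth)

lemma Bser_mmul:
  assumes "i < n" "j < n"
  shows "mmul n tA (Bser n) i j = (if i = j then detSer n else 0)"
    and "mmul n (Bser n) tA i j = (if i = j then detSer n else 0)"
  using mmul_adjn[OF assms, of tA] by (auto simp: Bser_def detSer_def)

lemma matInv_eq:
  assumes "i < n" "j < n"
  shows "matInv n i j = detInv n * Bser n i j"
proof -
  let ?N = "\<lambda>i j. if i < n \<and> j < n then detInv n * Bser n i j else 0"
  have N: "(\<Sum>l<n. ?N i l * tA l j) = (if i = j then 1 else 0)" if "i < n" "j < n" for i j
  proof -
    have "(\<Sum>l<n. ?N i l * tA l j) = detInv n * mmul n (Bser n) tA i j"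
      using that by (simp add: mmul_def sum_distrib_left mult_ac)
    then show ?thesis using that by (simp add: Bser_mmul detInv)
  qed
  have "matInv n = ?N"
    unfolding matInv_def
  proof (rule the_equality)
    fix M' :: "nat \<Rightarrow> nat \<Rightarrow> P fps"
    assume M': "(\<forall>i j. n \<le> i \<or> n \<le> j \<longrightarrow> M' i j = 0) \<and>
         (\<forall>i<n. \<forall>j<n. (\<Sum>l<n. M' i l * tA l j) = (if i = j then 1 else 0))"
    have "M' i j - ?N i j = 0" if ij: "i < n" "j < n" for i j
    proof (rule row_mult_cancel[where M = tA and r = "\<lambda>j. M' i j - ?N i j"])
      fix k assume "k < n"
      then have "(\<Sum>l<n. M' i l * tA l k) - (\<Sum>l<n. ?N i l * tA l k) = 0"
        using M' N[OF ij(1)] ij(1) by simp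
      then show "(\<Sum>l<n. (M' i l - ?N i l) * tA l k) = 0"
        by (simp only: left_diff_distrib sum_subtractf)
    qed (use detInv[of n] ij in \<open>simp_all add: detSer_def\<close>)
    then show "M' = ?N"
      using M' by (fastforce simp: fun_eq_iff)
  qed (use N in auto)
  then show ?thesis using assms by simp
qed

definition Rser :: "nat \<Rightarrow> nat \<Rightarrow> nat \<Rightarrow> P fps" where
  "Rser n i j = detInv n * detInv n * Bser n i j"

lemma Rc_eq: "i < n \<Longrightarrow> j < n \<Longrightarrow> Rc n a i j = fps_nth (Rser n i j) a"
  by (simp add: Rc_def rr_def matInv_eq Rser_def mult_ac)

lemma Rser_mmul:
  assumes "i < n" "j < n"
  shows "mmul n tA (Rser n) i j = (if i = j then detInv n else 0)"
    and "mmul n (Rser n) tA i j = (if i = j then detInv n else 0)"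
proof -
  have "mmul n tA (Rser n) i j = detInv n * detInv n * mmul n tA (Bser n) i j"
    "mmul n (Rser n) tA i j = detInv n * detInv n * mmul n (Bser n) tA i j"
    by (simp_all add: mmul_def Rser_def sum_distrib_left mult_ac)
  moreover have "detInv n * detInv n * detSer n = detInv n"
    using detInv[of n] by (simp add: mult.assoc)
  ultimately show "mmul n tA (Rser n) i j = (if i = j then detInv n else 0)"
    "mmul n (Rser n) tA i j = (if i = j then detInv n else 0)"
    using Bser_mmul[OF assms] by auto
qed

lemma mmul_tA:
  "i < n \<Longrightarrow> mmul n tA F i j = F i j - fps_X * (\<Sum>k<n. fps_const (matA i k) * F k j)"
  "j < n \<Longrightarrow> mmul n F tA i j = F i j - fps_X * (\<Sum>k<n. F i k * fps_const (matA k j))"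
  by (simp_all add: mmul_def oneMinusTA_def left_diff_distrib right_diff_distrib sum_subtractf
        sum_delta_mult sum_distrib_left mult_ac)

lemma coeff_recursion:
  assumes "i < n" "j < n" "mmul n tA F i j = (if i = j then D else 0)"
    "mmul n F tA i j = (if i = j then D else 0)"
  shows "fps_nth (F i j) 0 = (if i = j then fps_nth D 0 else 0)"
    and "fps_nth (F i j) (Suc a) = (if i = j then fps_nth D (Suc a) else 0) + mmul n matA (\<lambda>i j. fps_nth (F i j) a) i j"
    and "fps_nth (F i j) (Suc a) = (if i = j then fps_nth D (Suc a) else 0) + mmul n (\<lambda>i j. fps_nth (F i j) a) matA i j"
proof -
  have l: "F i j = (if i = j then D else 0) + fps_X * (\<Sum>k<n. fps_const (matA i k) * F k j)"
    using assms(3) mmul_tA(1)[OF assms(1), of F j] by (simp only: diff_eq_eq)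
  have r: "F i j = (if i = j then D else 0) + fps_X * (\<Sum>k<n. F i k * fps_const (matA k j))"
    using assms(4) mmul_tA(2)[OF assms(2), of F i] by (simp only: diff_eq_eq)
  show "fps_nth (F i j) 0 = (if i = j then fps_nth D 0 else 0)"
    by (subst l) simp
  show "fps_nth (F i j) (Suc a) = (if i = j then fps_nth D (Suc a) else 0) + mmul n matA (\<lambda>i j. fps_nth (F i j) a) i j"
    by (subst l) (simp add: mmul_def fps_sum_nth)
  show "fps_nth (F i j) (Suc a) = (if i = j then fps_nth D (Suc a) else 0) + mmul n (\<lambda>i j. fps_nth (F i j) a) matA i j"
    by (subst r) (simp add: mmul_def fps_sum_nth)
qed

lemma mmul_cong:
  "(\<And>k. k < n \<Longrightarrow> A i k = A' i k) \<Longrightarrow> (\<And>k. k < n \<Longrightarrow> B k j = B' k j) \<Longrightarrow> mmul n A B i j = mmul n A' B' i j"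
  by (simp add: mmul_def)

lemma Bc_0: "i < n \<Longrightarrow> j < n \<Longrightarrow> Bc n 0 i j = (if i = j then 1 else 0)"
  and Bc_Suc_left: "i < n \<Longrightarrow> j < n \<Longrightarrow> Bc n (Suc a) i j = (if i = j then Dc n (Suc a) else 0) + mmul n matA (Bc n a) i j"
  and Bc_Suc_right: "i < n \<Longrightarrow> j < n \<Longrightarrow> Bc n (Suc a) i j = (if i = j then Dc n (Suc a) else 0) + mmul n (Bc n a) matA i j"
  using coeff_recursion[OF _ _ Bser_mmul] Dc_0[of n] by (simp_all add: Bc_def[abs_def] Dc_def)

lemma Rc_0: "i < n \<Longrightarrow> j < n \<Longrightarrow> Rc n 0 i j = (if i = j then 1 else 0)"
  and Rc_Suc_left: "i < n \<Longrightarrow> j < n \<Longrightarrow> Rc n (Suc a) i j = (if i = j then hc n (Suc a) else 0) + mmul n matA (Rc n a) i j"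
  and Rc_Suc_right: "i < n \<Longrightarrow> j < n \<Longrightarrow> Rc n (Suc a) i j = (if i = j then hc n (Suc a) else 0) + mmul n (Rc n a) matA i j"
  using coeff_recursion[OF _ _ Rser_mmul] hc_0[of n]
  by (simp_all add: Rc_eq hc_def mmul_def)

lemma mmul_delta:
  "i < n \<Longrightarrow> mmul n (\<lambda>i j. if i = j then c else 0) F i j = c * F i j"
  "j < n \<Longrightarrow> mmul n F (\<lambda>i j. if i = j then c else 0) i j = F i j * c"
  by (simp_all add: mmul_def sum_delta_mult)

lemma mmul_add:
  "mmul n (\<lambda>i j. F i j + F' i j) G i j = mmul n F G i j + mmul n F' G i j"
  "mmul n G (\<lambda>i j. F i j + F' i j) i j = mmul n G F i j + mmul n G F' i j"
  by (simp_all add: mmul_def algebra_simps sum.distrib)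

lemma Bc_Rc_commute:
  assumes "i < n" "j < n"
  shows "mmul n (Bc n a) (Rc n b) i j = mmul n (Rc n b) (Bc n a) i j"
  using assms
proof (induction a arbitrary: i j)
  case 0
  have "mmul n (Bc n 0) (Rc n b) i j = mmul n (\<lambda>i j. if i = j then 1 else 0) (Rc n b) i j"
    "mmul n (Rc n b) (Bc n 0) i j = mmul n (Rc n b) (\<lambda>i j. if i = j then 1 else 0) i j"
    using 0 by (auto intro!: mmul_cong simp: Bc_0)
  then show ?case using 0 by (simp add: mmul_delta)
next
  case (Suc a)
  have RA: "mmul n (Rc n b) matA i j = mmul n matA (Rc n b) i j" if "i < n" "j < n" for i j
    using Rc_Suc_left[OF that, of b] Rc_Suc_right[OF that, of b] by simp
  let ?D = "\<lambda>i j. if i = j then Dc n (Suc a) else 0"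
  have "mmul n (Bc n (Suc a)) (Rc n b) i j =
      mmul n (\<lambda>i j. ?D i j + mmul n matA (Bc n a) i j) (Rc n b) i j"
    using Suc by (intro mmul_cong) (auto simp: Bc_Suc_left)
  also have "\<dots> = Dc n (Suc a) * Rc n b i j + mmul n matA (mmul n (Bc n a) (Rc n b)) i j"
    using Suc by (simp add: mmul_add mmul_delta mmul_assoc)
  also have "mmul n matA (mmul n (Bc n a) (Rc n b)) i j = mmul n (mmul n matA (Rc n b)) (Bc n a) i j"
    unfolding mmul_assoc by (rule mmul_cong) (simp_all add: Suc)
  also have "\<dots> = mmul n (mmul n (Rc n b) matA) (Bc n a) i j"
    by (rule mmul_cong) (simp_all add: Suc RA)
  also have "Dc n (Suc a) * Rc n b i j + \<dots> =
      mmul n (Rc n b) (\<lambda>i j. ?D i j + mmul n matA (Bc n a) i j) i j"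
    using Suc by (simp add: mmul_add mmul_delta mmul_assoc)
  also have "\<dots> = mmul n (Rc n b) (Bc n (Suc a)) i j"
    using Suc by (intro mmul_cong) (auto simp: Bc_Suc_left)
  finally show ?case .
qed

lemma resolvent_step:
  assumes "i < n" "j < n"
  shows "Dc n (Suc a) * Rc n b i j - Bc n a i j * hc n (Suc b) =
    mmul n (Bc n (Suc a)) (Rc n b) i j - mmul n (Bc n a) (Rc n (Suc b)) i j"
proof -
  have "mmul n (Bc n (Suc a)) (Rc n b) i j =
      mmul n (\<lambda>i j. (if i = j then Dc n (Suc a) else 0) + mmul n (Bc n a) matA i j) (Rc n b) i j"
    using assms by (intro mmul_cong) (auto simp: Bc_Suc_right)
  moreover have "mmul n (Bc n a) (Rc n (Suc b)) i j =
      mmul n (Bc n a) (\<lambda>i j. (if i = j then hc n (Suc b) else 0) + mmul n matA (Rc n b) i j) i j"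
    using assms by (intro mmul_cong) (auto simp: Rc_Suc_left)
  ultimately show ?thesis
    using assms by (simp add: mmul_add mmul_delta mmul_assoc)
qed

text \<open>The case distinction stands for the convention that \<open>Rc n (-1)\<close> is zero.\<close>

lemma resolvent_telescope:
  assumes "p < n" "q < n"
  shows "(\<Sum>l\<le>j. Dc n (Suc i + l) * (case j - l of 0 \<Rightarrow> 0 | Suc b \<Rightarrow> Rc n b p q) -
            Bc n (i + l) p q * hc n (j - l)) = - mmul n (Bc n i) (Rc n j) p q"
proof (induction j arbitrary: i)
  case 0
  have "mmul n (Bc n i) (Rc n 0) p q = mmul n (Bc n i) (\<lambda>i j. if i = j then 1 else 0) p q"
    using assms by (intro mmul_cong) (auto simp: Rc_0)
  then show ?case using assms by (simp add: hc_0 mmul_delta)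
next
  case (Suc j)
  show ?case
    using Suc[of "Suc i"] resolvent_step[OF assms, of i j]
    by (simp add: sum.atMost_Suc_shift del: sum.atMost_Suc)
qed

lemma dfps_tA:
  assumes "derivation (\<lambda>x. x) \<delta>"
  shows "dfps \<delta> (tA a b) = - (fps_X * fps_const (\<delta> (matA a b)))"
proof -
  interpret d: derivation "\<lambda>x. x" \<delta> by fact
  interpret derivation "\<lambda>x. x" "dfps \<delta>" by (rule dfps_derivation) fact
  have X: "dfps \<delta> fps_X = 0"
    by (simp add: fps_eq_iff)
  show ?thesis
    by (simp add: oneMinusTA_def diff mult X dfps_const mult.commute)
qed

lemma dfps_detSer:
  assumes "derivation (\<lambda>x. x) \<delta>"
  shows "dfps \<delta> (detSer n) = (\<Sum>i<n. \<Sum>j<n. dfps \<delta> (tA i j) * Bser n j i)"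
  unfolding detSer_def Bser_def by (rule derivation_detn[OF dfps_derivation[OF assms]])

lemma dfps_detInv:
  assumes "derivation (\<lambda>x. x) \<delta>"
  shows "dfps \<delta> (detInv n) = - (detInv n * detInv n * dfps \<delta> (detSer n))"
proof -
  interpret derivation "\<lambda>x. x" "dfps \<delta>" by (rule dfps_derivation) fact
  have "0 = dfps \<delta> (detInv n * detSer n)" by (simp add: detInv)
  also have "\<dots> = dfps \<delta> (detInv n) * detSer n + detInv n * dfps \<delta> (detSer n)" by (rule mult)
  finally have "0 = detInv n * (dfps \<delta> (detInv n) * detSer n + detInv n * dfps \<delta> (detSer n))" by simp
  also have "\<dots> = dfps \<delta> (detInv n) * (detInv n * detSer n) + detInv n * detInv n * dfps \<delta> (detSer n)"
    by (simp add: algebra_simps)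
  finally show ?thesis by (simp add: detInv eq_neg_iff_add_eq_0)
qed

lemma dfps_Bser_tA:
  assumes "derivation (\<lambda>x. x) \<delta>" "i < n" "j < n"
  shows "(\<Sum>k<n. dfps \<delta> (Bser n i k) * tA k j) =
      (if i = j then dfps \<delta> (detSer n) else 0) - (\<Sum>k<n. Bser n i k * dfps \<delta> (tA k j))"
    and "(\<Sum>k<n. tA i k * dfps \<delta> (Bser n k j)) =
      (if i = j then dfps \<delta> (detSer n) else 0) - (\<Sum>k<n. dfps \<delta> (tA i k) * Bser n k j)"
proof -
  interpret derivation "\<lambda>x. x" "dfps \<delta>" by (rule dfps_derivation) fact
  have "dfps \<delta> (mmul n (Bser n) tA i j) = (if i = j then dfps \<delta> (detSer n) else 0)"
    "dfps \<delta> (mmul n tA (Bser n) i j) = (if i = j then dfps \<delta> (detSer n) else 0)"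
    using assms by (simp_all add: Bser_mmul)
  then show "(\<Sum>k<n. dfps \<delta> (Bser n i k) * tA k j) =
      (if i = j then dfps \<delta> (detSer n) else 0) - (\<Sum>k<n. Bser n i k * dfps \<delta> (tA k j))"
    "(\<Sum>k<n. tA i k * dfps \<delta> (Bser n k j)) =
      (if i = j then dfps \<delta> (detSer n) else 0) - (\<Sum>k<n. dfps \<delta> (tA i k) * Bser n k j)"
    by (simp_all add: mmul_def sum mult sum.distrib eq_diff_eq add.commute)
qed


lemma y_derivation:
  assumes \<delta>: "derivation (\<lambda>x. x) \<delta>" and k: "k < n"
    and dA: "\<And>a b. a < n \<Longrightarrow> b < n \<Longrightarrow> \<delta> (matA a b) = (if a = k then y b else 0)"
  shows "\<delta> (Dc n (Suc a)) = - (\<Sum>b<n. y b * Bc n a b k)"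
    and "\<delta> (hc n (Suc a)) = (\<Sum>b<n. y b * Rc n a b k)"
    and "i < n \<Longrightarrow> (\<Sum>b<n. y b * \<delta> (Bc n a b i)) = 0"
proof -
  let ?y = "\<lambda>b. fps_const (y b)"
  have dM: "dfps \<delta> (tA a b) = (if a = k then - (fps_X * ?y b) else 0)" if "a < n" "b < n" for a b
    using that by (simp add: dfps_tA[OF \<delta>] dA)
  have dD: "dfps \<delta> (detSer n) = - (fps_X * (\<Sum>b<n. ?y b * Bser n b k))"
  proof -
    have "dfps \<delta> (detSer n) = (\<Sum>i<n. \<Sum>j<n. (if i = k then - (fps_X * ?y j) else 0) * Bser n j i)"
      unfolding dfps_detSer[OF \<delta>] by (intro sum.cong refl) (simp add: dM)
    also have "\<dots> = (\<Sum>i<n. if i = k then (\<Sum>j<n. - (fps_X * ?y j) * Bser n j i) else 0)"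
      by (intro sum.cong refl) simp
    also have "\<dots> = - (fps_X * (\<Sum>b<n. ?y b * Bser n b k))"
      using k by (simp add: sum_negf sum_distrib_left mult_ac)
    finally show ?thesis .
  qed
  then have "fps_nth (dfps \<delta> (detSer n)) (Suc a) = - (\<Sum>b<n. y b * Bc n a b k)"
    by (simp add: fps_sum_nth Bc_def)
  then show "\<delta> (Dc n (Suc a)) = - (\<Sum>b<n. y b * Bc n a b k)"
    by (simp add: Dc_def)
  have "dfps \<delta> (detInv n) = fps_X * (\<Sum>b<n. ?y b * Rser n b k)"
    unfolding dfps_detInv[OF \<delta>] dD Rser_def by (simp add: sum_distrib_left mult_ac)
  then have "fps_nth (dfps \<delta> (detInv n)) (Suc a) = (\<Sum>b<n. y b * fps_nth (Rser n b k) a)"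
    by (simp add: fps_sum_nth)
  then show "\<delta> (hc n (Suc a)) = (\<Sum>b<n. y b * Rc n a b k)"
    using k by (simp add: hc_def Rc_eq)
  show "(\<Sum>b<n. y b * \<delta> (Bc n a b i)) = 0" if i: "i < n"
  proof -
    have "(\<Sum>b<n. ?y b * dfps \<delta> (Bser n b i)) = 0"
    proof (rule row_mult_cancel[where M = tA and r = "\<lambda>c. \<Sum>b<n. ?y b * dfps \<delta> (Bser n b c)"])
      fix j assume j: "j < n"
      have "(\<Sum>c<n. (\<Sum>b<n. ?y b * dfps \<delta> (Bser n b c)) * tA c j) =
          (\<Sum>b<n. ?y b * (\<Sum>c<n. dfps \<delta> (Bser n b c) * tA c j))"
        unfolding sum_distrib_left sum_distrib_right by (subst sum.swap) (simp add: mult_ac)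
      also have "\<dots> = (\<Sum>b<n. ?y b * ((if b = j then dfps \<delta> (detSer n) else 0) + fps_X * ?y j * Bser n b k))"
      proof (intro sum.cong refl arg_cong2[of _ _ _ _ "(*)"])
        fix b assume b: "b \<in> {..<n}"
        have "(\<Sum>c<n. Bser n b c * dfps \<delta> (tA c j)) = (\<Sum>c<n. Bser n b c * (if c = k then - (fps_X * ?y j) else 0))"
          using j by (intro sum.cong) (auto simp: dM)
        also have "\<dots> = - (fps_X * ?y j * Bser n b k)"
          using k by (simp add: sum_delta_mult mult_ac)
        finally show "(\<Sum>c<n. dfps \<delta> (Bser n b c) * tA c j) =
            (if b = j then dfps \<delta> (detSer n) else 0) + fps_X * ?y j * Bser n b k"
          using b j by (simp add: dfps_Bser_tA(1)[OF \<delta>])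
      qed
      also have "\<dots> = ?y j * dfps \<delta> (detSer n) + fps_X * ?y j * (\<Sum>b<n. ?y b * Bser n b k)"
        using j by (simp add: distrib_left sum.distrib sum_delta_mult sum_distrib_left mult_ac)
      also have "\<dots> = 0" unfolding dD by (simp add: mult_ac)
      finally show "(\<Sum>c<n. (\<Sum>b<n. ?y b * dfps \<delta> (Bser n b c)) * tA c j) = 0" .
    qed (use detInv[of n] i in \<open>simp_all add: detSer_def\<close>)
    then have "fps_nth (\<Sum>b<n. ?y b * dfps \<delta> (Bser n b i)) a = 0" by simp
    then show ?thesis by (simp add: fps_sum_nth Bc_def)
  qed
qed

lemma x_derivation:
  assumes \<delta>: "derivation (\<lambda>x. x) \<delta>" and k: "k < n"
    and dA: "\<And>a b. a < n \<Longrightarrow> b < n \<Longrightarrow> \<delta> (matA a b) = - (if b = k then x a else 0)"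
  shows "\<delta> (Dc n (Suc a)) = (\<Sum>b<n. Bc n a k b * x b)"
    and "\<delta> (hc n (Suc a)) = - (\<Sum>b<n. Rc n a k b * x b)"
    and "i < n \<Longrightarrow> (\<Sum>b<n. \<delta> (Bc n a i b) * x b) = 0"
proof -
  let ?x = "\<lambda>b. fps_const (x b)"
  have dM: "dfps \<delta> (tA a b) = (if b = k then fps_X * ?x a else 0)" if "a < n" "b < n" for a b
    using that by (simp add: dfps_tA[OF \<delta>] dA flip: fps_const_neg)
  have dD: "dfps \<delta> (detSer n) = fps_X * (\<Sum>b<n. Bser n k b * ?x b)"
  proof -
    have "dfps \<delta> (detSer n) = (\<Sum>i<n. \<Sum>j<n. (if j = k then fps_X * ?x i else 0) * Bser n j i)"
      unfolding dfps_detSer[OF \<delta>] by (intro sum.cong refl) (simp add: dM)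
    also have "\<dots> = (\<Sum>i<n. fps_X * ?x i * Bser n k i)"
      using k by (simp add: sum_delta_mult)
    also have "\<dots> = fps_X * (\<Sum>b<n. Bser n k b * ?x b)"
      by (simp add: sum_distrib_left mult_ac)
    finally show ?thesis .
  qed
  then have "fps_nth (dfps \<delta> (detSer n)) (Suc a) = (\<Sum>b<n. Bc n a k b * x b)"
    by (simp add: fps_sum_nth Bc_def)
  then show "\<delta> (Dc n (Suc a)) = (\<Sum>b<n. Bc n a k b * x b)"
    by (simp add: Dc_def)
  have "dfps \<delta> (detInv n) = - (fps_X * (\<Sum>b<n. Rser n k b * ?x b))"
    unfolding dfps_detInv[OF \<delta>] dD Rser_def by (simp add: sum_distrib_left mult_ac)
  then have "fps_nth (dfps \<delta> (detInv n)) (Suc a) = - (\<Sum>b<n. fps_nth (Rser n k b) a * x b)"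
    by (simp add: fps_sum_nth)
  then show "\<delta> (hc n (Suc a)) = - (\<Sum>b<n. Rc n a k b * x b)"
    using k by (simp add: hc_def Rc_eq)
  show "(\<Sum>b<n. \<delta> (Bc n a i b) * x b) = 0" if i: "i < n"
  proof -
    have "(\<Sum>b<n. dfps \<delta> (Bser n i b) * ?x b) = 0"
    proof (rule col_mult_cancel[where M = tA and c = "\<lambda>c. \<Sum>b<n. dfps \<delta> (Bser n c b) * ?x b"])
      fix j assume j: "j < n"
      have "(\<Sum>c<n. tA j c * (\<Sum>b<n. dfps \<delta> (Bser n c b) * ?x b)) =
          (\<Sum>b<n. (\<Sum>c<n. tA j c * dfps \<delta> (Bser n c b)) * ?x b)"
        unfolding sum_distrib_left sum_distrib_right by (subst sum.swap) (simp add: mult_ac)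
      also have "\<dots> = (\<Sum>b<n. ((if j = b then dfps \<delta> (detSer n) else 0) - fps_X * ?x j * Bser n k b) * ?x b)"
      proof (intro sum.cong refl arg_cong2[of _ _ _ _ "(*)"])
        fix b assume b: "b \<in> {..<n}"
        have "(\<Sum>c<n. dfps \<delta> (tA j c) * Bser n c b) = (\<Sum>c<n. (if c = k then fps_X * ?x j else 0) * Bser n c b)"
          using j by (intro sum.cong) (auto simp: dM)
        then show "(\<Sum>c<n. tA j c * dfps \<delta> (Bser n c b)) =
            (if j = b then dfps \<delta> (detSer n) else 0) - fps_X * ?x j * Bser n k b"
          using b j k by (simp add: dfps_Bser_tA(2)[OF \<delta>] sum_delta_mult)
      qed
      also have "\<dots> = dfps \<delta> (detSer n) * ?x j - fps_X * ?x j * (\<Sum>b<n. Bser n k b * ?x b)"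
        using j by (simp add: left_diff_distrib sum_subtractf sum_delta_mult sum_distrib_left mult.assoc)
      also have "\<dots> = 0" unfolding dD by (simp add: mult_ac)
      finally show "(\<Sum>c<n. tA j c * (\<Sum>b<n. dfps \<delta> (Bser n c b) * ?x b)) = 0" .
    qed (use detInv[of n] i in \<open>simp_all add: detSer_def\<close>)
    then have "fps_nth (\<Sum>b<n. dfps \<delta> (Bser n i b) * ?x b) a = 0" by simp
    then show ?thesis by (simp add: fps_sum_nth Bc_def)
  qed
qed

lemma e_derivation:
  assumes \<delta>: "derivation (\<lambda>x. x) \<delta>" and k: "k < n" "l < n"
    and dA: "\<And>a b. a < n \<Longrightarrow> b < n \<Longrightarrow>
      \<delta> (matA a b) = (if a = k then matA l b else 0) - (if b = l then matA a k else 0)"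
  shows "\<delta> (Dc n a) = 0"
    and "\<delta> (hc n a) = 0"
    and "i < n \<Longrightarrow> j < n \<Longrightarrow> \<delta> (Bc n a i j) = (if i = k then Bc n a l j else 0) - (if j = l then Bc n a i k else 0)"
proof -
  have dM: "dfps \<delta> (tA a b) = (if a = k then tA l b else 0) - (if b = l then tA a k else 0)"
    if "a < n" "b < n" for a b
    using that unfolding dfps_tA[OF \<delta>] dA[OF that]
    by (auto simp: oneMinusTA_def algebra_simps simp flip: fps_const_sub fps_const_neg)
  have dD: "dfps \<delta> (detSer n) = 0"
  proof -
    have row: "(\<Sum>j<n. ((if i = k then tA l j else 0) - (if j = l then tA i k else 0)) * Bser n j i) =
        (if i = k then mmul n tA (Bser n) l k else 0) - Bser n l i * tA i k" for i
      using k by (cases "i = k") (simp_all add: left_diff_distrib sum_subtractf sum_negf sum_delta_mult mmul_def)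
    have "dfps \<delta> (detSer n) = (\<Sum>i<n. \<Sum>j<n. ((if i = k then tA l j else 0) - (if j = l then tA i k else 0)) * Bser n j i)"
      unfolding dfps_detSer[OF \<delta>] by (intro sum.cong refl) (simp add: dM)
    also have "\<dots> = mmul n tA (Bser n) l k - mmul n (Bser n) tA l k"
      unfolding row using k by (simp add: sum_subtractf) (simp add: mmul_def)
    also have "\<dots> = 0" using k by (simp add: Bser_mmul)
    finally show ?thesis .
  qed
  then have "fps_nth (dfps \<delta> (detSer n)) a = 0" by simp
  then show "\<delta> (Dc n a) = 0" by (simp add: Dc_def)
  have "fps_nth (dfps \<delta> (detInv n)) a = 0" unfolding dfps_detInv[OF \<delta>] dD by simp
  then show "\<delta> (hc n a) = 0" by (simp add: hc_def)
  show "\<delta> (Bc n a i j) = (if i = k then Bc n a l j else 0) - (if j = l then Bc n a i k else 0)"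
    if ij: "i < n" "j < n"
  proof -
    let ?C = "\<lambda>i j. (if i = k then Bser n l j else 0) - (if j = l then Bser n i k else 0)"
    have "dfps \<delta> (Bser n i j) - ?C i j = 0"
    proof (rule row_mult_cancel[where M = tA and r = "\<lambda>j. dfps \<delta> (Bser n i j) - ?C i j"])
      fix p assume p: "p < n"
      have "(\<Sum>c<n. dfps \<delta> (Bser n i c) * tA c p) =
          - (\<Sum>c<n. Bser n i c * ((if c = k then tA l p else 0) - (if p = l then tA c k else 0)))"
        using ij p by (simp add: dfps_Bser_tA(1)[OF \<delta>] dD dM)
      also have "\<dots> = (if p = l then mmul n (Bser n) tA i k else 0) - Bser n i k * tA l p"
        using k by (simp add: right_diff_distrib sum_subtractf sum_delta_mult mmul_def)
      also have "\<dots> = (if p = l \<and> i = k then detSer n else 0) - Bser n i k * tA l p"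
        using ij k by (simp add: Bser_mmul)
      finally have 1: "(\<Sum>c<n. dfps \<delta> (Bser n i c) * tA c p) = \<dots>" .
      have "(\<Sum>c<n. ?C i c * tA c p) = (if i = k then mmul n (Bser n) tA l p else 0) - Bser n i k * tA l p"
        using k by (simp add: left_diff_distrib sum_subtractf sum_delta_mult mmul_def)
      also have "\<dots> = (if p = l \<and> i = k then detSer n else 0) - Bser n i k * tA l p"
        using k p by (simp add: Bser_mmul)
      finally show "(\<Sum>c<n. (dfps \<delta> (Bser n i c) - ?C i c) * tA c p) = 0"
        unfolding left_diff_distrib[of "dfps \<delta> _"] sum_subtractf 1 by simp
    qed (use detInv[of n] ij in \<open>simp_all add: detSer_def\<close>)
    then have "fps_nth (dfps \<delta> (Bser n i j)) a = fps_nth (?C i j) a" by simp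
    then show ?thesis by (auto simp: Bc_def)
  qed
qed

section \<open>Centrality\<close>

text \<open>The coefficient of \<open>t\<close> to the power \<open>a + 1\<close> in the series \<open>c(t)\<close> for \<open>\<zeta>(z) = z\<close> to the power \<open>j\<close>.\<close>

definition Lc :: "nat \<Rightarrow> nat \<Rightarrow> nat \<Rightarrow> P" where
  "Lc n a j = (\<Sum>l\<le>j. Dc n (Suc a + l) * hc n (j - l))"

lemma fls_nth_cser:
  "fls_nth (cser n d zeta) (int (Suc a)) = (\<Sum>j\<le>d. cst (zeta j) * Lc n a j)"
proof -
  let ?H = "Abs_fps (\<lambda>m. fls_const (detInv n $ m)) * Abs_fps (\<lambda>l. (fls_X_inv :: P fls) ^ l)"
  let ?D = "fps_to_fls (detSer n)"
  have "cser n d zeta = fls_nth ((\<Sum>j\<le>d. fls_const (fls_const (cst (zeta j))) * fls_X_inv ^ j) *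
      (fls_const ?D * fps_to_fls ?H)) 0"
    unfolding cser_def Let_def fls_residue_def fls_X_inv_times_conv_shift fls_shift_nth
    by (simp add: fls_times_fps_to_fls mult.assoc pconst_eq_cst)
  also have "\<dots> = (\<Sum>j\<le>d. fls_nth (fls_const (fls_const (cst (zeta j)) * ?D) * (fls_X_inv ^ j * fps_to_fls ?H)) 0)"
    unfolding sum_distrib_right fls_nth_sum
    by (intro sum.cong refl arg_cong[of _ _ "\<lambda>f. fls_nth f 0"]) (simp only: mult_ac fls_const_mult_const[symmetric])
  also have "\<dots> = (\<Sum>j\<le>d. fls_const (cst (zeta j)) * ?D * fps_nth ?H j)"
    by (simp add: fls_X_inv_power_times_conv_shift)
  finally have c: "cser n d zeta = (\<Sum>j\<le>d. fls_const (cst (zeta j)) * ?D * fps_nth ?H j)" .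
  have shift: "fls_nth (?D * fls_X_inv ^ k) (int m) = Dc n (m + k)" for k m
    by (simp add: fls_X_inv_power_times_conv_shift Dc_def flip: of_nat_add)
  have "fls_nth (?D * fps_nth ?H j) (int (Suc a)) = Lc n a j" for j
  proof -
    have "?D * fps_nth ?H j = (\<Sum>i\<le>j. fls_const (hc n i) * (?D * fls_X_inv ^ (j - i)))"
      unfolding fps_mult_nth atLeast0AtMost sum_distrib_left
      by (intro sum.cong refl) (simp add: hc_def mult_ac)
    also have "fls_nth \<dots> (int (Suc a)) = (\<Sum>i\<le>j. hc n i * Dc n (Suc a + (j - i)))"
      by (simp only: fls_nth_sum fls_mult_const_nth shift)
    also have "\<dots> = Lc n a j"
      unfolding Lc_def
      by (rule sum.reindex_bij_witness[of _ "\<lambda>i. j - i" "\<lambda>i. j - i"]) (auto simp: mult.commute)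
    finally show ?thesis .
  qed
  then show ?thesis
    unfolding c fls_nth_sum by (simp add: mult.assoc)
qed

lemma E_gens [simp]: "E i j \<in> gens n \<longleftrightarrow> i < n \<and> j < n"
  and Y_gens [simp]: "Y i \<in> gens n \<longleftrightarrow> i < n"
  and X_gens [simp]: "X i \<in> gens n \<longleftrightarrow> i < n"
  by (auto simp: gens_def)

lemma gens_eq: "gens n = (\<lambda>(i, j). E i j) ` ({..<n} \<times> {..<n}) \<union> Y ` {..<n} \<union> X ` {..<n}"
proof (rule Set.set_eqI)
  fix v
  show "v \<in> gens n \<longleftrightarrow> v \<in> (\<lambda>(i, j). E i j) ` ({..<n} \<times> {..<n}) \<union> Y ` {..<n} \<union> X ` {..<n}"
    by (cases v) (auto intro: rev_image_eqI)
qed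

lemma finite_gens [simp]: "finite (gens n)"
  by (simp add: gens_eq)

lemma gens_cases:
  assumes "v \<in> gens n"
  obtains (E) i j where "v = E i j" "i < n" "j < n" | (Y) i where "v = Y i" "i < n"
    | (X) i where "v = X i" "i < n"
  using assms by (cases v) auto

definition ham :: "nat \<Rightarrow> nat \<Rightarrow> (nat \<Rightarrow> complex) \<Rightarrow> gvar \<Rightarrow> P \<Rightarrow> P" where
  "ham n d zeta v f = (\<Sum>u\<in>gens n. pd u f * genbr n d zeta u v)"

lemma pbr_eq_ham: "pbr n d zeta f g = (\<Sum>v\<in>gens n. pd v g * ham n d zeta v f)"
  unfolding pbr_def ham_def pdiff_eq_pd sum_distrib_left
  by (subst sum.swap) (simp add: mult_ac)

lemma pbr_var: "v \<in> gens n \<Longrightarrow> pbr n d zeta f (var v) = ham n d zeta v f"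
  unfolding pbr_eq_ham pd_var by (simp add: if_distrib[of "\<lambda>x. x * _"] cong: if_cong)

lemma poisson_center_iff:
  "f \<in> poisson_center n d zeta \<longleftrightarrow> f \<in> polys (gens n) \<and> (\<forall>v\<in>gens n. ham n d zeta v f = 0)"
proof -
  have "ham n d zeta v f = 0" if "f \<in> poisson_center n d zeta" "v \<in> gens n" for v
  proof -
    have "pbr n d zeta f (var v) = 0"
      using that by (auto simp: poisson_center_def Halg_eq_polys)
    then show ?thesis using that by (simp add: pbr_var)
  qed
  then show ?thesis
    by (auto simp: poisson_center_def Halg_eq_polys pbr_eq_ham)
qed

lemma ham_derivation: "derivation (\<lambda>x. x) (ham n d zeta v)"
  by (intro derivation.intro id_hom)
     (simp_all add: ham_def pd_add pd_mult sum_distrib_left sum.distrib algebra_simps)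

lemma ham_var: "u \<in> gens n \<Longrightarrow> ham n d zeta v (var u) = genbr n d zeta u v"
  unfolding ham_def pd_var by (simp add: if_distrib[of "\<lambda>x. x * _"] cong: if_cong)

lemma ham_cst [simp]: "ham n d zeta v (cst c) = 0"
  by (simp add: ham_def)

lemma ham_matA_Y:
  "k < n \<Longrightarrow> a < n \<Longrightarrow> b < n \<Longrightarrow> ham n d zeta (Y k) (matA a b) = (if a = k then var (Y b) else 0)"
  by (simp add: matA_def pvar_eq_var ham_var genbr_def)

lemma ham_matA_X:
  "k < n \<Longrightarrow> a < n \<Longrightarrow> b < n \<Longrightarrow> ham n d zeta (X k) (matA a b) = - (if b = k then var (X a) else 0)"
  by (simp add: matA_def pvar_eq_var ham_var genbr_def)

lemma ham_matA_E:
  "k < n \<Longrightarrow> l < n \<Longrightarrow> a < n \<Longrightarrow> b < n \<Longrightarrow>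
    ham n d zeta (E k l) (matA a b) = (if a = k then matA l b else 0) - (if b = l then matA a k else 0)"
  by (auto simp: matA_def pvar_eq_var ham_var genbr_def)

definition Qc :: "nat \<Rightarrow> nat \<Rightarrow> P" where
  "Qc n a = (\<Sum>b<n. \<Sum>i<n. var (Y b) * Bc n a b i * var (X i))"

lemma derivation_minus_one_power:
  assumes "derivation (\<lambda>x. x) \<delta>"
  shows "\<delta> ((-1) ^ a * f) = (-1) ^ a * \<delta> f"
proof -
  interpret derivation "\<lambda>x. x" \<delta> by fact
  show ?thesis by (cases "even a") (auto simp: uminus)
qed

lemma tauk_Suc: "tauk n d zeta (Suc a) = (-1) ^ a * Qc n a"
proof -
  have "pbr n d zeta (QQ n (Suc a)) (pvar (Y i)) = (-1) ^ a * (\<Sum>b<n. var (Y b) * Bc n a b i)"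
    if "i < n" for i
  proof -
    have "pbr n d zeta (QQ n (Suc a)) (pvar (Y i)) = ham n d zeta (Y i) ((-1) ^ Suc a * Dc n (Suc a))"
      using that by (simp add: pvar_eq_var pbr_var QQ_def Dc_def)
    also have "\<dots> = (-1) ^ Suc a * ham n d zeta (Y i) (Dc n (Suc a))"
      by (rule derivation_minus_one_power[OF ham_derivation])
    also have "\<dots> = (-1) ^ a * (\<Sum>b<n. var (Y b) * Bc n a b i)"
      using that by (subst y_derivation(1)[OF ham_derivation that, where y = "\<lambda>b. var (Y b)"])
        (simp_all add: ham_matA_Y)
    finally show ?thesis .
  qed
  then have "tauk n d zeta (Suc a) = (\<Sum>i<n. var (X i) * ((-1) ^ a * (\<Sum>b<n. var (Y b) * Bc n a b i)))"
    by (simp add: tauk_def pvar_eq_var)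
  also have "\<dots> = (-1) ^ a * Qc n a"
    unfolding Qc_def sum_distrib_left by (subst sum.swap) (simp add: mult_ac)
  finally show ?thesis .
qed

definition Kc :: "nat \<Rightarrow> nat \<Rightarrow> (nat \<Rightarrow> complex) \<Rightarrow> nat \<Rightarrow> P" where
  "Kc n d zeta a = Qc n a - (\<Sum>j\<le>d. cst (zeta j) * Lc n a j)"

lemma tauk_cc: "tauk n d zeta (Suc a) + cc n d zeta (Suc a) = (-1) ^ a * Kc n d zeta a"
  by (simp add: tauk_Suc cc_def fls_nth_cser Kc_def right_diff_distrib del: of_nat_Suc)

lemma ham_Y_Lc:
  assumes "k < n"
  shows "ham n d zeta (Y k) (Lc n a j) = - (\<Sum>b<n. var (Y b) * mmul n (Bc n a) (Rc n j) b k)"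
proof -
  interpret derivation "\<lambda>x. x" "ham n d zeta (Y k)" by (rule ham_derivation)
  note y = y_derivation[OF ham_derivation assms ham_matA_Y[OF assms]]
  have h: "ham n d zeta (Y k) (hc n m) = (\<Sum>b<n. var (Y b) * (case m of 0 \<Rightarrow> 0 | Suc m' \<Rightarrow> Rc n m' b k))" for m
    by (cases m) (simp_all add: y hc_0)
  have "ham n d zeta (Y k) (Lc n a j) = (\<Sum>l\<le>j. \<Sum>b<n. var (Y b) *
      (Dc n (Suc a + l) * (case j - l of 0 \<Rightarrow> 0 | Suc m \<Rightarrow> Rc n m b k) - Bc n (a + l) b k * hc n (j - l)))"
    unfolding Lc_def sum mult h
    by (simp add: y sum_distrib_left sum_distrib_right right_diff_distrib sum_subtractf mult_ac)
  also have "\<dots> = (\<Sum>b<n. var (Y b) * (\<Sum>l\<le>j.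
      Dc n (Suc a + l) * (case j - l of 0 \<Rightarrow> 0 | Suc m \<Rightarrow> Rc n m b k) - Bc n (a + l) b k * hc n (j - l)))"
    by (subst sum.swap) (simp only: sum_distrib_left)
  also have "\<dots> = (\<Sum>b<n. var (Y b) * - mmul n (Bc n a) (Rc n j) b k)"
    using assms by (intro sum.cong refl) (simp only: resolvent_telescope lessThan_iff)
  finally show ?thesis by (simp add: sum_negf)
qed

lemma ham_X_Lc:
  assumes "k < n"
  shows "ham n d zeta (X k) (Lc n a j) = (\<Sum>b<n. mmul n (Rc n j) (Bc n a) k b * var (X b))"
proof -
  interpret derivation "\<lambda>x. x" "ham n d zeta (X k)" by (rule ham_derivation)
  note x = x_derivation[OF ham_derivation assms ham_matA_X[OF assms]]
  have h: "ham n d zeta (X k) (hc n m) = - (\<Sum>b<n. (case m of 0 \<Rightarrow> 0 | Suc m' \<Rightarrow> Rc n m' k b) * var (X b))" for m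
    by (cases m) (simp_all add: x hc_0)
  have "ham n d zeta (X k) (Lc n a j) = - (\<Sum>l\<le>j. \<Sum>b<n.
      (Dc n (Suc a + l) * (case j - l of 0 \<Rightarrow> 0 | Suc m \<Rightarrow> Rc n m k b) - Bc n (a + l) k b * hc n (j - l)) * var (X b))"
    unfolding Lc_def sum mult h
    by (simp add: x sum_distrib_left sum_distrib_right right_diff_distrib sum_subtractf sum_negf mult_ac)
  also have "\<dots> = - (\<Sum>b<n. (\<Sum>l\<le>j.
      Dc n (Suc a + l) * (case j - l of 0 \<Rightarrow> 0 | Suc m \<Rightarrow> Rc n m k b) - Bc n (a + l) k b * hc n (j - l)) * var (X b))"
    by (subst sum.swap) (simp only: sum_distrib_right)
  also have "\<dots> = - (\<Sum>b<n. - mmul n (Bc n a) (Rc n j) k b * var (X b))"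
    using assms by (intro arg_cong[of _ _ uminus] sum.cong refl) (simp only: resolvent_telescope lessThan_iff)
  also have "\<dots> = (\<Sum>b<n. mmul n (Rc n j) (Bc n a) k b * var (X b))"
    using assms by (simp add: sum_negf Bc_Rc_commute)
  finally show ?thesis .
qed

lemma ham_E_Lc:
  assumes "k < n" "l < n"
  shows "ham n d zeta (E k l) (Lc n a j) = 0"
proof -
  interpret derivation "\<lambda>x. x" "ham n d zeta (E k l)" by (rule ham_derivation)
  note e = e_derivation[OF ham_derivation assms ham_matA_E[OF assms]]
  show ?thesis unfolding Lc_def sum mult by (simp add: e)
qed

lemma ham_Y_Qc:
  assumes "k < n"
  shows "ham n d zeta (Y k) (Qc n a) =
    - (\<Sum>j\<le>d. cst (zeta j) * (\<Sum>b<n. var (Y b) * mmul n (Bc n a) (Rc n j) b k))"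
proof -
  interpret derivation "\<lambda>x. x" "ham n d zeta (Y k)" by (rule ham_derivation)
  note y = y_derivation(3)[OF ham_derivation assms ham_matA_Y[OF assms]]
  have Y: "ham n d zeta (Y k) (var (Y b)) = 0" if "b < n" for b
    using that by (simp add: ham_var genbr_def)
  have X: "ham n d zeta (Y k) (var (X i)) = - (\<Sum>j\<le>d. cst (zeta j) * Rc n j i k)" if "i < n" for i
    using that by (simp add: ham_var genbr_def pconst_eq_cst Rc_def)
  have "ham n d zeta (Y k) (Qc n a) = (\<Sum>b<n. \<Sum>i<n. var (Y b) * ham n d zeta (Y k) (Bc n a b i) * var (X i)
      - (\<Sum>j\<le>d. cst (zeta j) * (var (Y b) * (Bc n a b i * Rc n j i k))))"
    unfolding Qc_def sum mult
    by (intro sum.cong refl) (simp add: Y X sum_distrib_left mult_ac)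
  also have "\<dots> = (\<Sum>i<n. (\<Sum>b<n. var (Y b) * ham n d zeta (Y k) (Bc n a b i)) * var (X i))
      - (\<Sum>b<n. \<Sum>i<n. \<Sum>j\<le>d. cst (zeta j) * (var (Y b) * (Bc n a b i * Rc n j i k)))"
    unfolding sum_subtractf sum_distrib_right by (rule arg_cong2[of _ _ _ _ "(-)", OF sum.swap refl])
  also have "(\<Sum>i<n. (\<Sum>b<n. var (Y b) * ham n d zeta (Y k) (Bc n a b i)) * var (X i)) = 0"
    by (simp add: y)
  also have "(\<Sum>b<n. \<Sum>i<n. \<Sum>j\<le>d. cst (zeta j) * (var (Y b) * (Bc n a b i * Rc n j i k))) =
      (\<Sum>b<n. \<Sum>j\<le>d. cst (zeta j) * (var (Y b) * mmul n (Bc n a) (Rc n j) b k))"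
    unfolding mmul_def sum_distrib_left by (intro sum.cong refl sum.swap)
  also have "\<dots> = (\<Sum>j\<le>d. cst (zeta j) * (\<Sum>b<n. var (Y b) * mmul n (Bc n a) (Rc n j) b k))"
    unfolding sum_distrib_left by (rule sum.swap)
  finally show ?thesis by simp
qed

lemma ham_X_Qc:
  assumes "k < n"
  shows "ham n d zeta (X k) (Qc n a) =
    (\<Sum>j\<le>d. cst (zeta j) * (\<Sum>b<n. mmul n (Rc n j) (Bc n a) k b * var (X b)))"
proof -
  interpret derivation "\<lambda>x. x" "ham n d zeta (X k)" by (rule ham_derivation)
  note x = x_derivation(3)[OF ham_derivation assms ham_matA_X[OF assms]]
  have X: "ham n d zeta (X k) (var (X b)) = 0" if "b < n" for b
    using that by (simp add: ham_var genbr_def)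
  have Y: "ham n d zeta (X k) (var (Y b)) = (\<Sum>j\<le>d. cst (zeta j) * Rc n j k b)" if "b < n" for b
    using that by (simp add: ham_var genbr_def pconst_eq_cst Rc_def)
  have "ham n d zeta (X k) (Qc n a) = (\<Sum>b<n. \<Sum>i<n. var (Y b) * (ham n d zeta (X k) (Bc n a b i) * var (X i))
      + (\<Sum>j\<le>d. cst (zeta j) * (Rc n j k b * Bc n a b i * var (X i))))"
    unfolding Qc_def sum mult
    by (intro sum.cong refl) (simp add: Y X sum_distrib_left algebra_simps)
  also have "\<dots> = (\<Sum>b<n. var (Y b) * (\<Sum>i<n. ham n d zeta (X k) (Bc n a b i) * var (X i)))
      + (\<Sum>b<n. \<Sum>i<n. \<Sum>j\<le>d. cst (zeta j) * (Rc n j k b * Bc n a b i * var (X i)))"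
    unfolding sum.distrib sum_distrib_left by simp
  also have "(\<Sum>b<n. var (Y b) * (\<Sum>i<n. ham n d zeta (X k) (Bc n a b i) * var (X i))) = 0"
    by (simp add: x)
  also have "(\<Sum>b<n. \<Sum>i<n. \<Sum>j\<le>d. cst (zeta j) * (Rc n j k b * Bc n a b i * var (X i))) =
      (\<Sum>i<n. \<Sum>b<n. \<Sum>j\<le>d. cst (zeta j) * (Rc n j k b * Bc n a b i * var (X i)))"
    by (rule sum.swap)
  also have "\<dots> = (\<Sum>i<n. \<Sum>j\<le>d. cst (zeta j) * (mmul n (Rc n j) (Bc n a) k i * var (X i)))"
    unfolding mmul_def sum_distrib_left sum_distrib_right by (intro sum.cong refl sum.swap)
  also have "\<dots> = (\<Sum>j\<le>d. cst (zeta j) * (\<Sum>b<n. mmul n (Rc n j) (Bc n a) k b * var (X b)))"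
    unfolding sum_distrib_left by (rule sum.swap)
  finally show ?thesis by simp
qed

lemma ham_E_Qc:
  assumes kl: "k < n" "l < n"
  shows "ham n d zeta (E k l) (Qc n a) = 0"
proof -
  interpret derivation "\<lambda>x. x" "ham n d zeta (E k l)" by (rule ham_derivation)
  note e = e_derivation(3)[OF ham_derivation assms ham_matA_E[OF assms]]
  let ?y = "\<lambda>b. var (Y b) :: P" and ?x = "\<lambda>i. var (X i) :: P"
  have Y: "ham n d zeta (E k l) (?y b) = - (if b = l then ?y k else 0)" if "b < n" for b
    using that by (simp add: ham_var genbr_def pvar_eq_var)
  have X: "ham n d zeta (E k l) (?x i) = (if i = k then ?x l else 0)" if "i < n" for i
    using that by (simp add: ham_var genbr_def pvar_eq_var)
  have "ham n d zeta (E k l) (Qc n a) = (\<Sum>b<n. \<Sum>i<n.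
      (if b = k then ?y b else 0) * (Bc n a l i * ?x i) - (if b = l then ?y k else 0) * (Bc n a b i * ?x i)
      + (?y b * Bc n a b i * (if i = k then ?x l else 0) - ?y b * Bc n a b k * (if i = l then ?x i else 0)))"
    unfolding Qc_def sum mult
    by (intro sum.cong refl) (simp add: Y X e algebra_simps)
  also have "\<dots> = ((\<Sum>b<n. (if b = k then ?y b else 0) * (\<Sum>i<n. Bc n a l i * ?x i))
        - (\<Sum>b<n. (if b = l then ?y k else 0) * (\<Sum>i<n. Bc n a b i * ?x i)))
      + ((\<Sum>b<n. \<Sum>i<n. ?y b * Bc n a b i * (if i = k then ?x l else 0))
        - (\<Sum>b<n. \<Sum>i<n. ?y b * Bc n a b k * (if i = l then ?x i else 0)))"
    unfolding sum.distrib sum_subtractf sum_distrib_left by simp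
  also have "(\<Sum>b<n. (if b = k then ?y b else 0) * (\<Sum>i<n. Bc n a l i * ?x i)) = ?y k * (\<Sum>i<n. Bc n a l i * ?x i)"
    using kl by (simp add: if_distrib[of "\<lambda>x. x * _"] cong: if_cong)
  also have "(\<Sum>b<n. (if b = l then ?y k else 0) * (\<Sum>i<n. Bc n a b i * ?x i)) = ?y k * (\<Sum>i<n. Bc n a l i * ?x i)"
    using kl by (simp only: sum_delta_mult)
  also have "(\<Sum>b<n. \<Sum>i<n. ?y b * Bc n a b i * (if i = k then ?x l else 0)) = (\<Sum>b<n. ?y b * Bc n a b k * ?x l)"
    using kl by (simp only: sum_delta_mult)
  also have "(\<Sum>b<n. \<Sum>i<n. ?y b * Bc n a b k * (if i = l then ?x i else 0)) = (\<Sum>b<n. ?y b * Bc n a b k * ?x l)"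
    using kl by (simp add: if_distrib[of "\<lambda>x. _ * x"] cong: if_cong)
  finally show ?thesis by simp
qed

lemma ham_Kc:
  assumes "v \<in> gens n"
  shows "ham n d zeta v (Kc n d zeta a) = 0"
proof -
  interpret derivation "\<lambda>x. x" "ham n d zeta v" by (rule ham_derivation)
  have K: "ham n d zeta v (Kc n d zeta a) =
      ham n d zeta v (Qc n a) - (\<Sum>j\<le>d. cst (zeta j) * ham n d zeta v (Lc n a j))"
    by (simp add: Kc_def diff sum mult)
  from assms show ?thesis
    unfolding K
    by (cases rule: gens_cases)
       (simp_all add: ham_E_Qc ham_E_Lc ham_X_Qc ham_X_Lc ham_Y_Qc ham_Y_Lc sum_negf)
qed

lemma Dc_in [simp]: "Dc n a \<in> polys (gens n)"
proof -
  let ?S = "\<lambda>F :: P fps. \<forall>m. fps_nth F m \<in> polys (gens n)"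
  have mult: "?S (F * G)" if "?S F" "?S G" for F G
    using that by (auto simp: fps_mult_nth)
  have prod: "?S (prod F I)" if "\<And>i. i \<in> I \<Longrightarrow> ?S (F i)" for F and I :: "nat set"
    using that by (induction I rule: infinite_finite_induct) (auto intro: mult[rule_format])
  have M: "?S (tA i j)" if "i < n" "j < n" for i j
    using that by (auto simp: oneMinusTA_def matA_def pvar_eq_var intro!: polys_uminus)
  have "?S (\<Prod>i<n. tA i (p i))" if "p permutes {..<n}" for p
    using that permutes_in_image[OF that] by (intro prod M) auto
  then have "?S (of_int (sign p) * (\<Prod>i<n. tA i (p i)))" if "p permutes {..<n}" for p
    using that by (auto simp: sign_def)
  then show ?thesis
    by (auto simp: Dc_def detSer_def detn_def fps_sum_nth)
qed

lemma hc_in [simp]: "hc n a \<in> polys (gens n)"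
proof (induction a rule: less_induct)
  case (less a)
  show ?case
  proof (cases a)
    case (Suc m)
    have "(\<Sum>i\<le>a. hc n i * Dc n (a - i)) = 0"
      using arg_cong[OF detInv[of n], of "\<lambda>F. fps_nth F a"] Suc
      by (simp add: fps_mult_nth hc_def Dc_def atLeast0AtMost)
    then have "hc n a = - (\<Sum>i<a. hc n i * Dc n (a - i))"
      by (simp add: lessThan_Suc_atMost[symmetric] Dc_0 eq_neg_iff_add_eq_0 add.commute)
    also have "\<dots> \<in> polys (gens n)"
      using less by (intro polys_uminus polys_sum polys_mult) auto
    finally show ?thesis .
  qed (simp add: hc_0)
qed

lemma Bc_in: "i < n \<Longrightarrow> j < n \<Longrightarrow> Bc n a i j \<in> polys (gens n)"
proof (induction a arbitrary: i j)
  case (Suc a)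
  have "mmul n matA (Bc n a) i j \<in> polys (gens n)"
    unfolding mmul_def using Suc by (auto simp: matA_def pvar_eq_var intro!: polys_sum polys_mult)
  then show ?case using Suc by (auto simp: Bc_Suc_left)
qed (auto simp: Bc_0)

lemma Kc_in: "Kc n d zeta a \<in> polys (gens n)"
  unfolding Kc_def Qc_def Lc_def
  by (intro polys_diff polys_sum polys_mult Bc_in) auto

lemma tauk_cc_central:
  assumes "1 \<le> i"
  shows "tauk n d zeta i + cc n d zeta i \<in> poisson_center n d zeta"
proof -
  obtain a where "i = Suc a" using assms by (cases i) auto
  moreover have "(-1 :: P) ^ a * Kc n d zeta a \<in> polys (gens n)"
    by (intro polys_mult polys_power polys_uminus polys_1 Kc_in)
  ultimately show ?thesis
    by (simp add: poisson_center_iff tauk_cc derivation_minus_one_power[OF ham_derivation] ham_Kc)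
qed

lemma ev_central:
  assumes "q \<in> polys S" "\<And>i. i \<in> S \<Longrightarrow> g i \<in> poisson_center n d zeta"
  shows "ev cst g q \<in> poisson_center n d zeta"
proof -
  interpret g: comm_ring_hom "ev cst g" by (intro ev_hom cst_hom)
  note [simp] = ev_cst[OF cst_hom] ev_var[OF cst_hom]
  have "ham n d zeta v (ev cst g q) = 0" if v: "v \<in> gens n" for v
  proof -
    interpret derivation "\<lambda>x. x" "ham n d zeta v" by (rule ham_derivation)
    show ?thesis
      using assms(1) by (induction q rule: polys_induct)
        (use assms(2) v in \<open>auto simp: poisson_center_iff g.hom_add g.hom_mult add mult\<close>)
  qed
  moreover have "ev cst g q \<in> polys (gens n)"
    using assms by (intro ev_in_polys) (auto simp: poisson_center_iff)
  ultimately show ?thesis by (simp add: poisson_center_iff)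
qed

section \<open>The slice\<close>

lemma fps_const_cst_hom: "comm_ring_hom (\<lambda>c. fps_const (cst c))"
  by unfold_locales (simp_all add: cst_add cst_mult)

lemma sum_gens:
  "(\<Sum>u\<in>gens n. g u) = (\<Sum>i<n. \<Sum>j<n. g (E i j)) + (\<Sum>i<n. g (Y i)) + (\<Sum>i<n. g (X i))"
proof -
  have "sum g ((\<lambda>(i, j). E i j) ` ({..<n} \<times> {..<n})) = (\<Sum>i<n. \<Sum>j<n. g (E i j))"
    by (subst sum.reindex) (auto simp: inj_on_def sum.cartesian_product case_prod_beta)
  moreover have "sum g (Y ` {..<n}) = (\<Sum>i<n. g (Y i))" "sum g (X ` {..<n}) = (\<Sum>i<n. g (X i))"
    by (auto simp: sum.reindex inj_on_def)
  ultimately show ?thesis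
    unfolding gens_eq by (subst sum.union_disjoint; auto)+
qed

definition slice_val :: "gvar \<Rightarrow> nat cpoly" where
  "slice_val v = (case v of E i j \<Rightarrow> if j = Suc i then 1 else 0 | X j \<Rightarrow> if j = 0 then 1 else 0
     | Y k \<Rightarrow> (-1) ^ k * var (Suc k))"

definition res :: "P \<Rightarrow> nat cpoly" where
  "res = ev cst slice_val"

interpretation res: comm_ring_hom res
  unfolding res_def by (intro ev_hom cst_hom)

lemma res_var [simp]: "res (var v) = slice_val v" and res_cst [simp]: "res (cst c) = cst c"
  by (simp_all add: res_def ev_var[OF cst_hom] ev_cst[OF cst_hom])

lemma res_matA: "res (matA i j) = (if i = Suc j then 1 else 0)"
  by (simp add: matA_def pvar_eq_var slice_val_def)

lemma res_Dc: "res (Dc n a) = (if a = 0 then 1 else 0)"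
proof -
  let ?\<Phi> = "\<lambda>F. Abs_fps (\<lambda>m. res (fps_nth F m))"
  interpret \<Phi>: comm_ring_hom ?\<Phi>
    by unfold_locales (simp_all add: fps_eq_iff fps_mult_nth res.hom_add res.hom_mult res.hom_sum)
  have "?\<Phi> (detSer n) = 1"
    unfolding detSer_def \<Phi>.hom_detn
    by (rule detn_lower_unitriangular)
       (auto simp: fps_eq_iff oneMinusTA_def res.hom_minus res.hom_uminus res_matA)
  from arg_cong[OF this, of "\<lambda>F. fps_nth F a"] show ?thesis
    by (simp add: Dc_def)
qed

lemma res_Bc: "i < n \<Longrightarrow> j < n \<Longrightarrow> res (Bc n a i j) = (if i = j + a then 1 else 0)"
proof (induction a arbitrary: i)
  case (Suc a)
  have "res (Bc n (Suc a) i j) = (\<Sum>k<n. (if i = Suc k then 1 else 0) * (if k = j + a then 1 else 0))"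
    using Suc by (simp add: Bc_Suc_left res_Dc mmul_def res.hom_add res.hom_sum res.hom_mult res_matA)
  also have "\<dots> = (if i = j + Suc a then 1 else 0)"
  proof (cases "j + a < n")
    case True
    then show ?thesis by (simp add: sum_delta_mult)
  qed (use Suc in auto)
  finally show ?case .
qed (simp add: Bc_0)

lemma res_Qc:
  assumes "a < n"
  shows "res (Qc n a) = (-1) ^ a * var (Suc a)"
proof -
  have "res (Qc n a) = (\<Sum>b<n. \<Sum>i<n. slice_val (Y b) * (if b = i + a then 1 else 0) * (if i = 0 then 1 else 0))"
    unfolding Qc_def by (simp add: res.hom_sum res.hom_mult res_Bc) (simp add: slice_val_def)
  also have "\<dots> = (\<Sum>b<n. slice_val (Y b) * (if b = a then 1 else 0))"
    using assms by (intro sum.cong refl) (subst sum_delta_mult(2), simp_all)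
  also have "\<dots> = slice_val (Y a)"
    using assms by (simp add: if_distrib[of "\<lambda>x. _ * x"] cong: if_cong)
  finally show ?thesis by (simp add: slice_val_def)
qed

lemma res_Kc:
  assumes "a < n"
  shows "res (Kc n d zeta a) = (-1) ^ a * var (Suc a)"
proof -
  have "res (Lc n a j) = 0" for j
    by (simp add: Lc_def res.hom_sum res.hom_mult res_Dc)
  then show ?thesis
    using assms by (simp add: Kc_def res.hom_minus res.hom_sum res.hom_mult res_Qc)
qed

lemma minus_one_power_cancel: "(-1 :: 'a::comm_ring_1) ^ a * ((-1) ^ a * x) = x"
  by (simp add: mult.assoc[symmetric] power_add[symmetric])

lemma res_tauk_cc:
  assumes "i \<in> {1..n}"
  shows "res (tauk n d zeta i + cc n d zeta i) = var i"
proof -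
  obtain a where a: "i = Suc a" using assms by (cases i) auto
  with assms have "res (Kc n d zeta a) = (-1) ^ a * var i" by (simp add: res_Kc)
  then show ?thesis
    unfolding a tauk_cc by (simp add: res.hom_mult res.hom_power res.hom_uminus minus_one_power_cancel a)
qed

lemma res_peval:
  assumes "pvars q \<subseteq> {1..n}"
  shows "res (peval q (\<lambda>i. tauk n d zeta i + cc n d zeta i)) = q"
proof -
  let ?g = "\<lambda>i. tauk n d zeta i + cc n d zeta i"
  interpret g: comm_ring_hom "ev cst ?g" by (intro ev_hom cst_hom)
  have "comm_ring_hom (\<lambda>q. res (ev cst ?g q))"
    by unfold_locales (simp_all add: g.hom_add g.hom_mult res.hom_add res.hom_mult)
  then have "res (ev cst ?g q) = q"
    by (rule hom_eqI[OF _ id_hom, where S = "{1..n}"])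
       (use assms in \<open>simp_all add: polys_def ev_var[OF cst_hom] ev_cst[OF cst_hom] res_tauk_cc\<close>)
  then show ?thesis by (simp add: peval_eq_ev)
qed

lemma res_in:
  assumes "f \<in> polys (gens n)"
  shows "pvars (res f) \<subseteq> {1..n}"
proof -
  have "res f \<in> polys {1..n}"
    unfolding res_def
  proof (rule ev_in_polys[OF assms])
    fix v assume "v \<in> gens n"
    then show "slice_val v \<in> polys {1..n}"
      by (cases rule: gens_cases) (auto simp: slice_val_def intro!: polys_mult polys_power polys_uminus)
  qed
  then show ?thesis by (simp add: polys_def)
qed

text \<open>The substitution moving the slice to the origin, with a parameter scaling the normal directions.\<close>

definition base :: "gvar \<Rightarrow> complex" where
  "base v = (case v of E i j \<Rightarrow> if j = Suc i then 1 else 0 | X j \<Rightarrow> if j = 0 then 1 else 0 | Y k \<Rightarrow> 0)"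

definition normal :: "gvar \<Rightarrow> bool" where
  "normal v = (case v of Y k \<Rightarrow> False | _ \<Rightarrow> True)"

definition shift_val :: "gvar \<Rightarrow> P fps" where
  "shift_val v = (if normal v then fps_const (cst (base v)) + fps_const (var v) * fps_X else fps_const (var v))"

definition shift :: "P \<Rightarrow> P fps" where
  "shift = ev (\<lambda>c. fps_const (cst c)) shift_val"

interpretation shift: comm_ring_hom shift
  unfolding shift_def by (intro ev_hom fps_const_cst_hom)

lemma shift_var [simp]: "shift (var v) = shift_val v" and shift_cst [simp]: "shift (cst c) = fps_const (cst c)"
  by (simp_all add: shift_def ev_var[OF fps_const_cst_hom] ev_cst[OF fps_const_cst_hom])

lemma shift_0:
  assumes "res f = 0"
  shows "fps_nth (shift f) 0 = 0"
proof -
  define lift :: "nat cpoly \<Rightarrow> P" where "lift = ev cst (\<lambda>m. (-1) ^ (m - 1) * var (Y (m - 1)))"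
  interpret lift: comm_ring_hom lift unfolding lift_def by (intro ev_hom cst_hom)
  have b: "lift (var m) = (-1) ^ (m - 1) * var (Y (m - 1))" "lift (cst c) = cst c" for m c
    by (simp_all add: lift_def ev_var[OF cst_hom] ev_cst[OF cst_hom])
  have "fps_nth (shift f) 0 = lift (res f)"
  proof (rule hom_eqI[where S = UNIV and h = "\<lambda>f. fps_nth (shift f) 0" and h' = "\<lambda>f. lift (res f)"])
    show "comm_ring_hom (\<lambda>f. fps_nth (shift f) 0)"
      by unfold_locales (simp_all add: shift.hom_add shift.hom_mult fps_mult_nth)
    show "comm_ring_hom (\<lambda>f. lift (res f))"
      by unfold_locales (simp_all add: res.hom_add res.hom_mult lift.hom_add lift.hom_mult)
    show "fps_nth (shift (var v)) 0 = lift (res (var v))" for v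
      by (cases v) (auto simp: shift_val_def normal_def base_def slice_val_def b
          lift.hom_mult lift.hom_power lift.hom_uminus minus_one_power_cancel)
  qed (simp_all add: b)
  then show ?thesis using assms by simp
qed

lemma shift_inj:
  assumes "shift f = 0"
  shows "f = 0"
proof -
  define shp :: "P \<Rightarrow> P poly" where
    "shp = ev (\<lambda>c. [:cst c:]) (\<lambda>v. if normal v then [:cst (base v), var v:] else [:var v:])"
  have kh: "comm_ring_hom (\<lambda>c. [:cst c :: P:])"
    by unfold_locales (simp_all add: cst_add cst_mult)
  interpret shp: comm_ring_hom shp unfolding shp_def by (intro ev_hom kh)
  have s: "shp (var v) = (if normal v then [:cst (base v), var v:] else [:var v:])" "shp (cst c) = [:cst c:]" for v c
    by (simp_all add: shp_def ev_var[OF kh] ev_cst[OF kh])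
  define lift :: "P \<Rightarrow> P" where "lift = ev cst (\<lambda>v. if normal v then var v - cst (base v) else var v)"
  interpret lift: comm_ring_hom lift unfolding lift_def by (intro ev_hom cst_hom)
  have b: "lift (var v) = (if normal v then var v - cst (base v) else var v)" "lift (cst c) = cst c" for v c
    by (simp_all add: lift_def ev_var[OF cst_hom] ev_cst[OF cst_hom])
  have "shift f = fps_of_poly (shp f)"
  proof (rule hom_eqI[where S = UNIV and h' = "\<lambda>f. fps_of_poly (shp f)"])
    show "comm_ring_hom shift" by (fact shift.comm_ring_hom_axioms)
    show "comm_ring_hom (\<lambda>f. fps_of_poly (shp f))"
      by unfold_locales (simp_all add: shp.hom_add shp.hom_mult fps_of_poly_add fps_of_poly_mult)
    show "shift (var v) = fps_of_poly (shp (var v))" for v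
      by (simp add: s shift_val_def fps_of_poly_pCons mult.commute)
  qed (simp_all add: s fps_of_poly_const)
  with assms have 0: "shp f = 0" by simp
  have "lift (poly (shp f) 1) = f"
  proof (rule hom_eqI[where S = UNIV and h = "\<lambda>f. lift (poly (shp f) 1)" and h' = "\<lambda>f. f"])
    show "comm_ring_hom (\<lambda>f. lift (poly (shp f) 1))"
      by unfold_locales (simp_all add: shp.hom_add shp.hom_mult lift.hom_add lift.hom_mult)
  qed (simp_all add: s b id_hom lift.hom_add)
  with 0 show ?thesis by simp
qed

lemma fps_decompose: "(F :: P fps) = fps_const (fps_nth F 0) + fps_shift 1 F * fps_X"
  by (simp add: fps_eq_iff)

lemma pd_shift:
  assumes "f \<in> polys (gens n)" "v \<in> gens n"
  shows "dfps (pd v) (shift f) = shift (pd v f) * (if normal v then fps_X else 1)"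
proof -
  interpret d: derivation "\<lambda>x. x" "dfps (pd v) :: P fps \<Rightarrow> P fps"
    by (intro dfps_derivation pd_derivation)
  have "derivation shift (\<lambda>f. dfps (pd v) (shift f))"
    by (intro derivation.intro) (simp_all add: shift.comm_ring_hom_axioms shift.hom_add shift.hom_mult d.add d.mult)
  then have "dfps (pd v) (shift f) = (\<Sum>u\<in>gens n. shift (pd u f) * dfps (pd v) (shift (var u)))"
    by (rule derivation_chain) (use assms in \<open>simp_all add: dfps_const\<close>)
  also have "\<dots> = (\<Sum>u\<in>gens n. if u = v then shift (pd v f) * (if normal v then fps_X else 1) else 0)"
  proof (intro sum.cong refl)
    fix u
    have "dfps (pd v) fps_X = 0" by (auto simp: fps_eq_iff fps_X_def pd_cst[of v 1, simplified])
    then show "shift (pd u f) * dfps (pd v) (shift (var u)) =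
        (if u = v then shift (pd v f) * (if normal v then fps_X else 1) else 0)"
      by (auto simp: shift_val_def d.add d.mult dfps_const pd_var)
  qed
  finally show ?thesis using assms by simp
qed

lemma fps_deriv_shift:
  assumes "f \<in> polys (gens n)"
  shows "fps_deriv (shift f) = (\<Sum>u\<in>gens n. shift (pd u f) * (if normal u then fps_const (var u) else 0))"
proof -
  have "derivation shift (\<lambda>f. fps_deriv (shift f))"
    by (intro derivation.intro) (simp_all add: shift.comm_ring_hom_axioms shift.hom_add shift.hom_mult)
  then have "fps_deriv (shift f) = (\<Sum>u\<in>gens n. shift (pd u f) * fps_deriv (shift (var u)))"
    by (rule derivation_chain) (use assms in simp_all)
  then show ?thesis
    by (simp add: shift_val_def if_distrib[of fps_deriv] cong: if_cong)
qed

definition dspan :: "nat \<Rightarrow> P fps \<Rightarrow> P fps set" where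
  "dspan n F = range (\<lambda>h. \<Sum>v\<in>gens n. h v * dfps (pd v) F)"

lemma dspanI: "(\<Sum>v\<in>gens n. h v * dfps (pd v) F) \<in> dspan n F"
  unfolding dspan_def by (rule rangeI)

lemma dspan_add: "G \<in> dspan n F \<Longrightarrow> H \<in> dspan n F \<Longrightarrow> G + H \<in> dspan n F"
proof -
  assume "G \<in> dspan n F" "H \<in> dspan n F"
  then obtain g h where "G = (\<Sum>v\<in>gens n. g v * dfps (pd v) F)" "H = (\<Sum>v\<in>gens n. h v * dfps (pd v) F)"
    by (auto simp: dspan_def)
  then have "G + H = (\<Sum>v\<in>gens n. (g v + h v) * dfps (pd v) F)"
    by (simp add: distrib_right sum.distrib)
  then show ?thesis by (simp only: dspanI)
qed

lemma dspan_mult: "G \<in> dspan n F \<Longrightarrow> H * G \<in> dspan n F"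
proof -
  assume "G \<in> dspan n F"
  then obtain g where "G = (\<Sum>v\<in>gens n. g v * dfps (pd v) F)" by (auto simp: dspan_def)
  then have "H * G = (\<Sum>v\<in>gens n. (H * g v) * dfps (pd v) F)"
    by (simp add: sum_distrib_left mult.assoc)
  then show ?thesis by (simp only: dspanI)
qed

lemma dspan_0: "0 \<in> dspan n F"
  unfolding dspan_def by (rule range_eqI[of _ _ "\<lambda>_. 0"]) simp

lemma dspan_uminus: "G \<in> dspan n F \<Longrightarrow> - G \<in> dspan n F"
  using dspan_mult[of G n F "- 1"] by simp

lemma dspan_diff: "G \<in> dspan n F \<Longrightarrow> H \<in> dspan n F \<Longrightarrow> G - H \<in> dspan n F"
  using dspan_add[of G n F "- H"] dspan_uminus[of H] by simp

lemma dspan_sum: "(\<And>i. i \<in> I \<Longrightarrow> g i \<in> dspan n F) \<Longrightarrow> sum g I \<in> dspan n F"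
  by (induction I rule: infinite_finite_induct) (auto intro: dspan_0 dspan_add)

lemma dspan_pd:
  assumes "v \<in> gens n"
  shows "dfps (pd v) F \<in> dspan n F"
proof -
  have "dfps (pd v) F = (\<Sum>u\<in>gens n. (if u = v then 1 else 0) * dfps (pd u) F)"
    using assms by (simp add: if_distrib[of "\<lambda>x. x * _"] cong: if_cong)
  then show ?thesis by (simp only: dspanI)
qed

lemma dspan_deriv_imp_0:
  assumes "fps_deriv F \<in> dspan n F" "fps_nth F 0 = 0"
  shows "F = 0"
proof -
  obtain h where h: "fps_deriv F = (\<Sum>v\<in>gens n. h v * dfps (pd v) F)"
    using assms(1) by (auto simp: dspan_def)
  have "fps_nth F m = 0" for m
  proof (induction m rule: less_induct)
    case (less m)
    show ?case
    proof (cases m)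
      case (Suc k)
      have "of_nat (Suc k) * fps_nth F (Suc k) = fps_nth (fps_deriv F) k" by simp
      also have "\<dots> = 0"
        unfolding h using less Suc by (auto simp: fps_sum_nth fps_mult_nth intro!: sum.neutral)
      finally have "cst (inverse (of_nat (Suc k))) * (of_nat (Suc k) * fps_nth F (Suc k)) = 0" by simp
      moreover have "(of_nat (Suc k) :: P) = cst (of_nat (Suc k))"
        by (simp only: cst_def single_of_nat)
      ultimately have "cst (inverse (of_nat (Suc k)) * of_nat (Suc k)) * fps_nth F (Suc k) = 0"
        by (simp only: mult.assoc cst_mult)
      then show ?thesis using Suc by (simp del: of_nat_Suc)
    qed (use assms in simp)
  qed
  then show ?thesis by (simp add: fps_eq_iff)
qed

text \<open>Modulo \<^const>\<open>dspan\<close>, the relations \<open>{f, v} = 0\<close> only involve their values on the slice. There they say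
  that the matrix \<open>G\<close> of derivatives of \<open>f\<close> along the \<open>e\<^sub>i\<^sub>j\<close> is constant along diagonals and zero at
  one end of each.\<close>

lemma ham_zero_imp_zero:
  assumes f: "f \<in> polys (gens n)" and ham: "\<And>v. v \<in> gens n \<Longrightarrow> normal v \<Longrightarrow> ham n d zeta v f = 0"
    and res: "res f = 0"
  shows "f = 0"
proof -
  let ?Z = "dspan n (shift f)"
  define G where "G u = shift (pd u f)" for u
  have XG: "G u * fps_X \<in> ?Z" if "u \<in> gens n" "normal u" for u
    using dspan_pd[OF that(1), of "shift f"] pd_shift[OF f that(1)] that by (simp add: G_def)
  have GY: "G u \<in> ?Z" if "u \<in> gens n" "\<not> normal u" for u
    using dspan_pd[OF that(1), of "shift f"] pd_shift[OF f that(1)] that by (simp add: G_def)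
  define c where "c u v = (if normal u then fps_nth (shift (genbr n d zeta u v)) 0 else 0)" for u v
  have rel: "(\<Sum>u\<in>gens n. G u * fps_const (c u v)) \<in> ?Z" if v: "v \<in> gens n" "normal v" for v
  proof -
    have "(\<Sum>u\<in>gens n. G u * shift (genbr n d zeta u v)) = 0"
      using arg_cong[OF ham[OF v], of shift]
      by (simp add: ham_def shift.hom_sum shift.hom_mult G_def)
    then have "(\<Sum>u\<in>gens n. G u * fps_const (c u v)) =
        - (\<Sum>u\<in>gens n. G u * (shift (genbr n d zeta u v) - fps_const (c u v)))"
      by (simp add: right_diff_distrib sum_subtractf)
    also have "\<dots> \<in> ?Z"
    proof (intro dspan_uminus dspan_sum)
      fix u assume u: "u \<in> gens n"
      show "G u * (shift (genbr n d zeta u v) - fps_const (c u v)) \<in> ?Z"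
      proof (cases "normal u")
        case True
        then have "shift (genbr n d zeta u v) - fps_const (c u v) = fps_shift 1 (shift (genbr n d zeta u v)) * fps_X"
          using fps_decompose[of "shift (genbr n d zeta u v)"] by (simp add: c_def diff_eq_eq add.commute)
        then show ?thesis
          using dspan_mult[OF XG[OF u True], of "fps_shift 1 (shift (genbr n d zeta u v))"] by (simp add: mult_ac)
      next
        case False
        then show ?thesis
          using dspan_mult[OF GY[OF u False], of "shift (genbr n d zeta u v) - fps_const (c u v)"]
          by (simp add: mult.commute)
      qed
    qed
    finally show ?thesis .
  qed
  have s0: "fps_nth (shift (var v)) 0 = cst (base v)" if "normal v" for v
    using that by (simp add: shift_val_def)
  have n [simp]: "normal (E i j)" "normal (X i)" "\<not> normal (Y i)" for i j
    by (simp_all add: normal_def)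
  have cX: "c (E i j) (X k) = (if i = k \<and> j = 0 then -1 else 0)" "c (X i) (X k) = 0" for i j k
    by (auto simp: c_def genbr_def pvar_eq_var shift.hom_uminus s0 base_def simp del: shift_var)
  have cE: "c (E i j) (E k l) = (if j = k then if Suc i = l then 1 else 0 else 0) - (if l = i then if j = Suc k then 1 else 0 else 0)"
    "c (X i) (E k l) = (if i = k then if l = 0 then 1 else 0 else 0)" for i j k l
    by (auto simp: c_def genbr_def pvar_eq_var shift.hom_minus s0 base_def simp del: shift_var)
  have [simp]: "fps_const (- 1 :: P) = - 1" by (simp flip: fps_const_neg)
  have cY: "c (Y i) v = 0" for i v by (simp add: c_def)
  have first_col: "G (E k 0) \<in> ?Z" if "k < n" for k
  proof -
    have "(\<Sum>u\<in>gens n. G u * fps_const (c u (X k))) = (\<Sum>i<n. \<Sum>j<n. if i = k \<and> j = 0 then - G (E i j) else 0)"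
      by (auto simp: sum_gens cX cY intro!: sum.cong)
    also have "\<dots> = (\<Sum>i<n. if i = k then - G (E i 0) else 0)"
      using that by (intro sum.cong refl) (auto simp: sum.delta')
    also have "\<dots> = - G (E k 0)" using that by simp
    finally show ?thesis
      using rel[of "X k"] that dspan_uminus[of "- G (E k 0)"] by simp
  qed
  have diag: "(if l = 0 then G (X k) else G (E (l - 1) k)) - (if Suc k < n then G (E l (Suc k)) else 0) \<in> ?Z"
    if kl: "k < n" "l < n" for k l
  proof -
    have "(\<Sum>i<n. \<Sum>j<n. G (E i j) * fps_const (c (E i j) (E k l))) =
        (\<Sum>i<n. \<Sum>j<n. (if Suc i = l then if j = k then G (E i j) else 0 else 0) - (if i = l then if j = Suc k then G (E i j) else 0 else 0))"
      by (intro sum.cong refl) (auto simp: cE)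
    moreover have "(\<Sum>i<n. G (X i) * fps_const (c (X i) (E k l))) =
        (\<Sum>i<n. if i = k then if l = 0 then G (X i) else 0 else 0)"
      by (intro sum.cong refl) (auto simp: cE)
    ultimately have "(\<Sum>u\<in>gens n. G u * fps_const (c u (E k l))) =
        (\<Sum>i<n. \<Sum>j<n. (if Suc i = l then if j = k then G (E i j) else 0 else 0) - (if i = l then if j = Suc k then G (E i j) else 0 else 0))
        + (\<Sum>i<n. if i = k then if l = 0 then G (X i) else 0 else 0)"
      by (simp only: sum_gens cY fps_const_0_eq_0 mult_zero_right sum.neutral_const add_0_right)
    also have "(\<Sum>i<n. if i = k then if l = 0 then G (X i) else 0 else 0) = (if l = 0 then G (X k) else 0)"
      using kl by simp
    also have "(\<Sum>i<n. \<Sum>j<n. (if Suc i = l then if j = k then G (E i j) else 0 else 0) - (if i = l then if j = Suc k then G (E i j) else 0 else 0))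
        = (\<Sum>i<n. if Suc i = l then G (E i k) else 0) - (\<Sum>i<n. if i = l then (if Suc k < n then G (E i (Suc k)) else 0) else 0)"
      unfolding sum_subtractf using kl by (intro arg_cong2[of _ _ _ _ "(-)"] sum.cong refl) (auto simp: sum.delta)
    also have "(\<Sum>i<n. if i = l then (if Suc k < n then G (E i (Suc k)) else 0) else 0) = (if Suc k < n then G (E l (Suc k)) else 0)"
      using kl by simp
    also have "(\<Sum>i<n. if Suc i = l then G (E i k) else 0) = (if l = 0 then 0 else G (E (l - 1) k))"
      using kl by (cases l) auto
    finally have "(\<Sum>u\<in>gens n. G u * fps_const (c u (E k l))) =
        (if l = 0 then G (X k) else G (E (l - 1) k)) - (if Suc k < n then G (E l (Suc k)) else 0)"
      by simp
    then show ?thesis using rel[of "E k l"] kl by simp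
  qed
  have lower: "G (E j i) \<in> ?Z" if "i \<le> j" "j < n" for i j
    using that
  proof (induction i arbitrary: j)
    case (Suc i)
    then have "G (E (j - 1) i) \<in> ?Z" by simp
    with diag[of i j] Suc.prems dspan_diff[of "G (E (j - 1) i)" n "shift f" "G (E (j - 1) i) - G (E j (Suc i))"]
    show ?case by (simp split: if_splits)
  qed (simp add: first_col)
  have upper: "G (E j i) \<in> ?Z" if "j < i" "i < n" for i j
    using that
  proof (induction "n - i" arbitrary: i j rule: less_induct)
    case less
    have "G (E j i) - (if Suc i < n then G (E (Suc j) (Suc i)) else 0) \<in> ?Z"
      using diag[of i "Suc j"] less.prems by simp
    moreover have "(if Suc i < n then G (E (Suc j) (Suc i)) else 0) \<in> ?Z"
      using less.hyps[of "Suc i" "Suc j"] less.prems by (auto simp: dspan_0)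
    ultimately show ?case
      using dspan_add by fastforce
  qed
  have GE: "G (E i j) \<in> ?Z" if "i < n" "j < n" for i j
    using lower[of j i] upper[of i j] that by linarith
  have GX: "G (X k) \<in> ?Z" if "k < n" for k
  proof -
    have "G (X k) - (if Suc k < n then G (E 0 (Suc k)) else 0) \<in> ?Z"
      using diag[of k 0] that by simp
    moreover have "(if Suc k < n then G (E 0 (Suc k)) else 0) \<in> ?Z"
      using GE that by (auto simp: dspan_0)
    ultimately show ?thesis
      using dspan_add by fastforce
  qed
  have "fps_deriv (shift f) \<in> ?Z"
    unfolding fps_deriv_shift[OF f]
  proof (intro dspan_sum)
    fix u assume u: "u \<in> gens n"
    show "shift (pd u f) * (if normal u then fps_const (var u) else 0) \<in> ?Z"
    proof (cases "normal u")
      case True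
      with u have "G u \<in> ?Z"
        by (cases rule: gens_cases) (auto simp: GE GX)
      from dspan_mult[OF this, of "fps_const (var u)"] True show ?thesis
        by (simp add: G_def mult.commute)
    qed (simp add: dspan_0)
  qed
  then have "shift f = 0"
    using shift_0[OF res] by (rule dspan_deriv_imp_0)
  then show ?thesis by (rule shift_inj)
qed

theorem theorem5p2:
  fixes n d :: nat and zeta :: "nat \<Rightarrow> complex"
  assumes "n \<ge> 1"
  shows "poisson_center n d zeta =
           {peval q (\<lambda>i. tauk n d zeta i + cc n d zeta i) | q. pvars q \<subseteq> {1..n}}
       \<and> (\<forall>q. pvars q \<subseteq> {1..n} \<longrightarrow> peval q (\<lambda>i. tauk n d zeta i + cc n d zeta i) = 0 \<longrightarrow> q = 0)"
proof -
  let ?g = "\<lambda>i. tauk n d zeta i + cc n d zeta i"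
  have central: "peval q ?g \<in> poisson_center n d zeta" if "pvars q \<subseteq> {1..n}" for q
    unfolding peval_eq_ev using that
    by (intro ev_central[where S = "{1..n}"] tauk_cc_central) (auto simp: polys_def)
  have "f = peval (res f) ?g" if f: "f \<in> poisson_center n d zeta" for f
  proof -
    let ?h = "f - peval (res f) ?g"
    have vars: "pvars (res f) \<subseteq> {1..n}"
      using f by (intro res_in) (simp add: poisson_center_iff)
    note c = f central[OF vars]
    have "?h = 0"
    proof (rule ham_zero_imp_zero)
      show "?h \<in> polys (gens n)"
        using c by (auto simp: poisson_center_iff)
      show "ham n d zeta v ?h = 0" if "v \<in> gens n" for v
        using c that by (simp add: poisson_center_iff derivation.diff[OF ham_derivation])
      show "res ?h = 0"
        by (simp add: res.hom_minus res_peval[OF vars])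
    qed
    then show ?thesis by simp
  qed
  moreover have "pvars (res f) \<subseteq> {1..n}" if "f \<in> poisson_center n d zeta" for f
    using that by (intro res_in) (simp add: poisson_center_iff)
  ultimately have "poisson_center n d zeta = {peval q ?g | q. pvars q \<subseteq> {1..n}}"
    using central by blast
  moreover have "q = 0" if "pvars q \<subseteq> {1..n}" "peval q ?g = 0" for q
    using res_peval[OF that(1), of d zeta] that(2) by simp
  ultimately show ?thesis by blast
qed

end
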